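(* Let $(\mathbf X,\mathcal X,\mu)$ and $(\mathbf Z,\mathcal Z,\nu)$ be measure spaces with $\mu(\mathbf X)=1$ and with $L^2(\mu),L^2(\nu)$ real separable Hilbert spaces. Let $K:L^2(\nu)\to L^2(\mu)$ be a bounded injective linear operator and put $R=(K^*K)^{1/2}$, with polar decomposition $K=VR$. Assume that $L^2(\nu)$ has an orthonormal basis $\varphi_0,\varphi_1,\dots$ of eigenfunctions of $R$ with eigenvalues $\rho_0,\rho_1,\dots>0$ satisfying $\sup_{k\ge0}\rho_k<\infty$. Put $\varphi_{V,k}=V\varphi_k$ and assume $\sup_{z\in\mathbf Z,k\ge0}|\varphi_k(z)|<\infty$ and $\sup_{x\in\mathbf X,k\ge0}|\varphi_{V,k}(x)|<\infty$. Let $f\in L^2(\nu)$, $f_k=\langle f,\varphi_k\rangle$, and let $(X_1,Y_1),(X_2,Y_2),\dots$ be independent copies of $(X,Y)$, where $Y=(Kf)(X)+\varepsilon$, $X$ has distribution $\mu$, and $\varepsilon$ is independent of $X$, with $\mathbf E\varepsilon=0$, $\mathbf E\varepsilon^2=\sigma^2<\infty$, and known density $\psi$ with respect to Lebesgue measure on $\mathbb R$. Assume that $\psi''$ exists on $\mathbb R$, and that, with $\Lambda=-\psi'/\psi$, the derivatives $\Lambda'$ and $\Lambda''$ exist and are bounded on $\mathbb R$, and $$\mathbf E\Lambda^2(\varepsilon)=\mathbf E\Lambda'(\varepsilon)=\int_{-\infty}^\infty\Big(\frac{\psi'}{\psi}\Big)^2(y)\,\psi(y)\,dy=I(\psi)<\infty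 .$$ Let $m=m(n)$ be a sequence with $m\to\infty$ and $m/\sqrt n\to0$ as $n\to\infty$, for which $$\sqrt n\sum_{k>m}f_k^2\to0\quad\text{and}\quad\sum_{k>m}|f_k|\to0,\qquad\text{as } n\to\infty .$$ Define $$\hat f_k=\frac1n\sum_{i=1}^n\frac1{\rho_k}Y_i\,\varphi_{V,k}(X_i),\qquad \hat f_{(m)}=\sum_{k\le m}\hat f_k\varphi_k,$$ $$\hat{\hat f}_0=\hat f_0+\frac1n\sum_{i=1}^n\frac1{\rho_0I(\psi)}\,\Lambda\big(Y_i-(K\hat f_{(m)})(X_i)\big)\,\varphi_{V,0}(X_i).$$ Then $\hat{\hat f}_0$ is an asymptotically efficient estimator of $f_0=\langle f,\varphi_0\rangle$, i.e. $$\sqrt n\,(\hat{\hat f}_0-f_0)\to_d \mathrm{Normal}\Big(0,\frac1{\rho_0^2I(\psi)}\Big),\qquad\text{as } n\to\infty,$$ where the variance of this normal distribution is optimal, i.e. $\frac1{\rho_0^2I(\psi)}=\widetilde\sigma_0^2(f)$.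
   Context: Polar decomposition: $V:L^2(\nu)\to L^2(\mu)$ is the partial isometry with $K=VR$, $K^*=RV^*$; $V^*V$ is the identity on the range of $R$, and the $\varphi_{V,k}=V\varphi_k$ are orthonormal in $L^2(\mu)$. The notation $\to_d$ means convergence in distribution. The indices $k$ run over $0,1,2,\dots$. The existence of $\Lambda$ on all of $\mathbb R$ presupposes $\psi>0$. Optimal variance (in the sense of the Hájek–Le Cam convolution theorem). The pair $(X,Y)$ has density $p_f(x,y)=\psi(y-(Kf)(x))$ with respect to $\mu\times\lambda$, where $\lambda$ is Lebesgue measure on $\mathbb R$; put $s_f=\sqrt{p_f}$. With $\overline{\mathfrak R_K}$ the closure of the range of $K$ in $L^2(\mu)$, the tangent space at $f$ is $$\dot{\mathcal S}_f=\{\dot s_{f,h}: h\in\overline{\mathfrak R_K}\}\subset L^2(\mu\times\lambda),\qquad \dot s_{f,h}(x,y)=-\frac{\psi'(y-(Kf)(x))}{2s_f(x,y)}\,h(x).$$ The gradient at $f$ of the functional $f\mapsto\langle f,\varphi_0\rangle$ is $$\dot T_f(x,y)=\frac2{\rho_0}\,(y-(Kf)(x))\,\varphi_{V,0}(x)\,s_f(x,y).$$ Let $\widetilde T_f$ be the orthogonal projection in $L^2(\mu\times\lambda)$ of $\dot T_f$ onto $\dot{\mathcal S}_f$. The optimal variance is $\widetilde\sigma_0^2(f)=\frac14\|\widetilde T_f\|^2$. An estimator $\hat\theta_n$ of $f_0$ is asymptotically efficient if $\sqrt n(\hat\theta_n-f_0)\to_d\mathrm{Normal}(0,\widetilde\sigma_0^2(f))$.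 *)

theory Defs
  imports "HOL-Probability.Probability"
begin

section \<open>Real \<open>L\<^sup>2\<close> spaces\<close>

text \<open>
  An element of \<open>L\<^sup>2(M)\<close> is represented by a square-integrable measurable function;
  two functions that agree almost everywhere represent the same element. Accordingly,
  an operator maps representatives to representatives and all operator identities are
  required almost everywhere only.
\<close>

definition L2 :: "'a measure \<Rightarrow> ('a \<Rightarrow> real) set" where
  "L2 M = {f \<in> borel_measurable M. integrable M (\<lambda>x. (f x)\<^sup>2)}"

definition L2_inner :: "'a measure \<Rightarrow> ('a \<Rightarrow> real) \<Rightarrow> ('a \<Rightarrow> real) \<Rightarrow> real" where
  "L2_inner M f g = (\<integral>x. f x * g x \<partial>M)"

definition L2_norm :: "'a measure \<Rightarrow> ('a \<Rightarrow> real) \<Rightarrow> real" where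
  "L2_norm M f = sqrt (L2_inner M f f)"

definition L2_separable :: "'a measure \<Rightarrow> bool" where
  "L2_separable M \<longleftrightarrow>
     (\<exists>D. countable D \<and> D \<subseteq> L2 M \<and>
        (\<forall>f\<in>L2 M. \<forall>e>0. \<exists>d\<in>D. L2_norm M (\<lambda>x. f x - d x) < e))"

definition L2_orthonormal :: "'a measure \<Rightarrow> (nat \<Rightarrow> 'a \<Rightarrow> real) \<Rightarrow> bool" where
  "L2_orthonormal M \<phi> \<longleftrightarrow>
     (\<forall>k. \<phi> k \<in> L2 M) \<and> (\<forall>j k. L2_inner M (\<phi> j) (\<phi> k) = (if j = k then 1 else 0))"

definition L2_orthonormal_basis :: "'a measure \<Rightarrow> (nat \<Rightarrow> 'a \<Rightarrow> real) \<Rightarrow> bool" where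
  "L2_orthonormal_basis M \<phi> \<longleftrightarrow>
     L2_orthonormal M \<phi> \<and>
     (\<forall>f\<in>L2 M. (\<lambda>N. L2_norm M (\<lambda>x. f x - (\<Sum>k<N. L2_inner M f (\<phi> k) * \<phi> k x))) \<longlonglongrightarrow> 0)"

text \<open>Bounded linear operators; boundedness makes them respect almost-everywhere equality.\<close>

definition L2_operator ::
  "'a measure \<Rightarrow> 'b measure \<Rightarrow> (('a \<Rightarrow> real) \<Rightarrow> ('b \<Rightarrow> real)) \<Rightarrow> bool" where
  "L2_operator M N T \<longleftrightarrow>
     (\<forall>f\<in>L2 M. T f \<in> L2 N) \<and>
     (\<forall>f\<in>L2 M. \<forall>g\<in>L2 M. AE x in N. T (\<lambda>z. f z + g z) x = T f x + T g x) \<and>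
     (\<forall>f\<in>L2 M. \<forall>c. AE x in N. T (\<lambda>z. c * f z) x = c * T f x) \<and>
     (\<exists>B. \<forall>f\<in>L2 M. L2_norm N (T f) \<le> B * L2_norm M f)"

definition L2_injective ::
  "'a measure \<Rightarrow> 'b measure \<Rightarrow> (('a \<Rightarrow> real) \<Rightarrow> ('b \<Rightarrow> real)) \<Rightarrow> bool" where
  "L2_injective M N T \<longleftrightarrow>
     (\<forall>f\<in>L2 M. \<forall>g\<in>L2 M. (AE x in N. T f x = T g x) \<longrightarrow> (AE z in M. f z = g z))"

definition L2_adjoint ::
  "'a measure \<Rightarrow> 'b measure \<Rightarrow> (('a \<Rightarrow> real) \<Rightarrow> ('b \<Rightarrow> real)) \<Rightarrow>
     (('b \<Rightarrow> real) \<Rightarrow> ('a \<Rightarrow> real)) \<Rightarrow> bool" where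
  "L2_adjoint M N T S \<longleftrightarrow>
     L2_operator N M S \<and>
     (\<forall>f\<in>L2 M. \<forall>g\<in>L2 N. L2_inner N (T f) g = L2_inner M f (S g))"

text \<open>\<open>R\<close> is the positive square root of the operator \<open>A\<close>.\<close>

definition L2_positive_sqrt ::
  "'a measure \<Rightarrow> (('a \<Rightarrow> real) \<Rightarrow> ('a \<Rightarrow> real)) \<Rightarrow>
     (('a \<Rightarrow> real) \<Rightarrow> ('a \<Rightarrow> real)) \<Rightarrow> bool" where
  "L2_positive_sqrt M A R \<longleftrightarrow>
     L2_adjoint M M R R \<and>
     (\<forall>f\<in>L2 M. 0 \<le> L2_inner M (R f) f) \<and>
     (\<forall>f\<in>L2 M. AE z in M. R (R f) z = A f z)"

text \<open>A partial isometry is isometric on the orthogonal complement of its kernel.\<close>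

definition L2_partial_isometry ::
  "'a measure \<Rightarrow> 'b measure \<Rightarrow> (('a \<Rightarrow> real) \<Rightarrow> ('b \<Rightarrow> real)) \<Rightarrow> bool" where
  "L2_partial_isometry M N V \<longleftrightarrow>
     L2_operator M N V \<and>
     (\<forall>f\<in>L2 M. (\<forall>g\<in>L2 M. (AE x in N. V g x = 0) \<longrightarrow> L2_inner M f g = 0)
        \<longrightarrow> L2_norm N (V f) = L2_norm M f)"

definition L2_polar_decomposition ::
  "'a measure \<Rightarrow> 'b measure \<Rightarrow> (('a \<Rightarrow> real) \<Rightarrow> ('b \<Rightarrow> real)) \<Rightarrow>
     (('b \<Rightarrow> real) \<Rightarrow> ('a \<Rightarrow> real)) \<Rightarrow> (('a \<Rightarrow> real) \<Rightarrow> ('b \<Rightarrow> real)) \<Rightarrow>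
     (('b \<Rightarrow> real) \<Rightarrow> ('a \<Rightarrow> real)) \<Rightarrow> (('a \<Rightarrow> real) \<Rightarrow> ('a \<Rightarrow> real)) \<Rightarrow> bool" where
  "L2_polar_decomposition M N K Kstar V Vstar R \<longleftrightarrow>
     L2_positive_sqrt M (\<lambda>f. Kstar (K f)) R \<and>
     L2_partial_isometry M N V \<and>
     L2_adjoint M N V Vstar \<and>
     (\<forall>f\<in>L2 M. AE x in N. K f x = V (R f) x) \<and>
     (\<forall>g\<in>L2 N. AE z in M. Kstar g z = R (Vstar g) z) \<and>
     (\<forall>f\<in>L2 M. AE z in M. Vstar (V (R f)) z = R f z)"

definition L2_range_closure ::
  "'a measure \<Rightarrow> 'b measure \<Rightarrow> (('a \<Rightarrow> real) \<Rightarrow> ('b \<Rightarrow> real)) \<Rightarrow> ('b \<Rightarrow> real) set" where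
  "L2_range_closure M N T =
     {h \<in> L2 N. \<forall>e>0. \<exists>f\<in>L2 M. L2_norm N (\<lambda>x. h x - T f x) < e}"

definition L2_is_projection ::
  "'a measure \<Rightarrow> ('a \<Rightarrow> real) set \<Rightarrow> ('a \<Rightarrow> real) \<Rightarrow> ('a \<Rightarrow> real) \<Rightarrow> bool" where
  "L2_is_projection M S u v \<longleftrightarrow>
     u \<in> L2 M \<and> v \<in> L2 M \<and> v \<in> S \<and> (\<forall>s\<in>S. L2_inner M (\<lambda>x. u x - v x) s = 0)"

definition L2_projection ::
  "'a measure \<Rightarrow> ('a \<Rightarrow> real) set \<Rightarrow> ('a \<Rightarrow> real) \<Rightarrow> ('a \<Rightarrow> real)" where
  "L2_projection M S u = (SOME v. L2_is_projection M S u v)"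


section \<open>Point evaluation of \<open>K g\<close> for \<open>g\<close> in the span of the basis\<close>

text \<open>
  The estimator evaluates \<open>K g\<close>, with \<open>g\<close> a random combination of \<open>\<phi> 0, ..., \<phi> m\<close>, at random
  points on which \<open>g\<close> depends. Such evaluations are meaningful only if the representatives of
  \<open>K g\<close> are chosen coherently in \<open>g\<close>. The representative used is the one that is linear in \<open>g\<close>
  at every point; the lemma \<open>AE_span_version\<close> below shows that it is a representative
  of \<open>K g\<close>.
\<close>

definition span_version ::
  "'a measure \<Rightarrow> (nat \<Rightarrow> 'a \<Rightarrow> real) \<Rightarrow> nat \<Rightarrow>
     (('a \<Rightarrow> real) \<Rightarrow> ('b \<Rightarrow> real)) \<Rightarrow> ('a \<Rightarrow> real) \<Rightarrow> 'b \<Rightarrow> real" where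
  "span_version M \<phi> m K g x = (\<Sum>k\<le>m. L2_inner M g (\<phi> k) * K (\<phi> k) x)"

lemma L2_mult_integrable:
  assumes "f \<in> L2 M" "g \<in> L2 M"
  shows "integrable M (\<lambda>x. f x * g x)"
proof (rule Bochner_Integration.integrable_bound)
  show "integrable M (\<lambda>x. (f x)\<^sup>2 + (g x)\<^sup>2)"
    using assms by (auto simp: L2_def)
  show "(\<lambda>x. f x * g x) \<in> borel_measurable M"
    using assms by (auto simp: L2_def)
  have "\<bar>a * b\<bar> \<le> a\<^sup>2 + b\<^sup>2" for a b :: real
  proof -
    have "0 \<le> (\<bar>a\<bar> - \<bar>b\<bar>)\<^sup>2" by simp
    then have "2 * (\<bar>a\<bar> * \<bar>b\<bar>) \<le> a\<^sup>2 + b\<^sup>2"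
      by (simp add: power2_diff)
    moreover have "0 \<le> \<bar>a\<bar> * \<bar>b\<bar>" by simp
    ultimately show ?thesis unfolding abs_mult by linarith
  qed
  then show "AE x in M. norm (f x * g x) \<le> norm ((f x)\<^sup>2 + (g x)\<^sup>2)"
    by simp
qed

lemma L2_scale: "f \<in> L2 M \<Longrightarrow> (\<lambda>x. c * f x) \<in> L2 M"
  by (auto simp: L2_def power_mult_distrib)

lemma L2_add: "f \<in> L2 M \<Longrightarrow> g \<in> L2 M \<Longrightarrow> (\<lambda>x. f x + g x) \<in> L2 M"
  using L2_mult_integrable[of f M g]
  by (auto simp: L2_def power2_sum mult.assoc)

lemma L2_lincomb:
  "(\<And>k. \<phi> k \<in> L2 M) \<Longrightarrow> (\<lambda>z. \<Sum>k\<le>(m::nat). c k * \<phi> k z) \<in> L2 M"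
  by (induction m) (auto intro!: L2_add L2_scale)

lemma L2_operator_lincomb:
  assumes K: "L2_operator M N K" and \<phi>: "\<And>k. \<phi> k \<in> L2 M"
  shows "AE x in N. K (\<lambda>z. \<Sum>k\<le>(m::nat). c k * \<phi> k z) x = (\<Sum>k\<le>m. c k * K (\<phi> k) x)"
proof (induction m)
  case 0
  then show ?case using K \<phi> by (auto simp: L2_operator_def)
next
  case (Suc m)
  have "AE x in N. K (\<lambda>z. (\<Sum>k\<le>m. c k * \<phi> k z) + c (Suc m) * \<phi> (Suc m) z) x
      = K (\<lambda>z. \<Sum>k\<le>m. c k * \<phi> k z) x + K (\<lambda>z. c (Suc m) * \<phi> (Suc m) z) x"
  proof -
    have "\<forall>g\<in>L2 M. \<forall>h\<in>L2 M. AE x in N. K (\<lambda>z. g z + h z) x = K g x + K h x"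
      using K unfolding L2_operator_def by blast
    from this[rule_format, OF L2_lincomb[of \<phi> M c m, OF \<phi>]
        L2_scale[of "\<phi> (Suc m)" M "c (Suc m)", OF \<phi>]]
    show ?thesis .
  qed
  moreover have "AE x in N. K (\<lambda>z. c (Suc m) * \<phi> (Suc m) z) x = c (Suc m) * K (\<phi> (Suc m)) x"
    using K \<phi> by (auto simp: L2_operator_def)
  ultimately show ?case using Suc by eventually_elim simp
qed

lemma L2_inner_lincomb:
  assumes "L2_orthonormal M \<phi>" "j \<le> m"
  shows "L2_inner M (\<lambda>z. \<Sum>k\<le>(m::nat). c k * \<phi> k z) (\<phi> j) = c j"
proof -
  have \<phi>: "\<And>k. \<phi> k \<in> L2 M"
    and on: "\<And>i k. (\<integral>x. \<phi> i x * \<phi> k x \<partial>M) = (if i = k then 1 else 0)"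
    using assms(1) by (auto simp: L2_orthonormal_def L2_inner_def)
  have "L2_inner M (\<lambda>z. \<Sum>k\<le>m. c k * \<phi> k z) (\<phi> j)
      = (\<integral>z. (\<Sum>k\<le>m. c k * (\<phi> k z * \<phi> j z)) \<partial>M)"
    by (simp add: L2_inner_def sum_distrib_right mult.assoc)
  also have "\<dots> = (\<Sum>k\<le>m. c k * (\<integral>z. \<phi> k z * \<phi> j z \<partial>M))"
    using L2_mult_integrable[OF \<phi> \<phi>] by (subst Bochner_Integration.integral_sum) auto
  also have "\<dots> = c j" using assms(2) by (simp add: on if_distrib cong: if_cong)
  finally show ?thesis .
qed

lemma AE_span_version:
  assumes "L2_operator M N K" "L2_orthonormal M \<phi>"
    and "g = (\<lambda>z. \<Sum>k\<le>m. c k * \<phi> k z)"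
  shows "AE x in N. K g x = span_version M \<phi> m K g x"
proof -
  have "span_version M \<phi> m K g x = (\<Sum>k\<le>m. c k * K (\<phi> k) x)" for x
    using L2_inner_lincomb[OF assms(2)] by (simp add: span_version_def assms(3))
  moreover have "\<And>k. \<phi> k \<in> L2 M" using assms(2) by (simp add: L2_orthonormal_def)
  ultimately show ?thesis
    using L2_operator_lincomb[OF assms(1)] by (simp add: assms(3))
qed


section \<open>Score function, Fisher information and optimal variance\<close>

definition score :: "(real \<Rightarrow> real) \<Rightarrow> real \<Rightarrow> real" where
  "score \<psi> y = - deriv \<psi> y / \<psi> y"

definition fisher_information :: "(real \<Rightarrow> real) \<Rightarrow> real" where
  "fisher_information \<psi> = (\<integral>y. (deriv \<psi> y / \<psi> y)\<^sup>2 * \<psi> y \<partial>lborel)"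

text \<open>
  In the following definitions \<open>g\<close> stands for the regression function \<open>K f\<close> and \<open>v\<^sub>0\<close> for
  the function \<open>V (\<phi> 0)\<close>.
\<close>

definition root_density :: "(real \<Rightarrow> real) \<Rightarrow> ('x \<Rightarrow> real) \<Rightarrow> 'x \<times> real \<Rightarrow> real" where
  "root_density \<psi> g = (\<lambda>(x, y). sqrt (\<psi> (y - g x)))"

definition tangent_vector ::
  "(real \<Rightarrow> real) \<Rightarrow> ('x \<Rightarrow> real) \<Rightarrow> ('x \<Rightarrow> real) \<Rightarrow> 'x \<times> real \<Rightarrow> real" where
  "tangent_vector \<psi> g h =
     (\<lambda>(x, y). - (deriv \<psi> (y - g x) / (2 * root_density \<psi> g (x, y))) * h x)"

definition tangent_space ::
  "'z measure \<Rightarrow> 'x measure \<Rightarrow> (('z \<Rightarrow> real) \<Rightarrow> ('x \<Rightarrow> real)) \<Rightarrow>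
     (real \<Rightarrow> real) \<Rightarrow> ('z \<Rightarrow> real) \<Rightarrow> ('x \<times> real \<Rightarrow> real) set" where
  "tangent_space \<nu> \<mu> K \<psi> f = tangent_vector \<psi> (K f) ` L2_range_closure \<nu> \<mu> K"

definition functional_gradient ::
  "(real \<Rightarrow> real) \<Rightarrow> ('x \<Rightarrow> real) \<Rightarrow> real \<Rightarrow> ('x \<Rightarrow> real) \<Rightarrow> 'x \<times> real \<Rightarrow> real" where
  "functional_gradient \<psi> g \<rho>\<^sub>0 v\<^sub>0 =
     (\<lambda>(x, y). 2 / \<rho>\<^sub>0 * (y - g x) * v\<^sub>0 x * root_density \<psi> g (x, y))"

definition optimal_variance ::
  "'z measure \<Rightarrow> 'x measure \<Rightarrow> (('z \<Rightarrow> real) \<Rightarrow> ('x \<Rightarrow> real)) \<Rightarrow>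
     (real \<Rightarrow> real) \<Rightarrow> real \<Rightarrow> ('x \<Rightarrow> real) \<Rightarrow> ('z \<Rightarrow> real) \<Rightarrow> real" where
  "optimal_variance \<nu> \<mu> K \<psi> \<rho>\<^sub>0 v\<^sub>0 f =
     1 / 4 * (L2_norm (\<mu> \<Otimes>\<^sub>M lborel)
       (L2_projection (\<mu> \<Otimes>\<^sub>M lborel) (tangent_space \<nu> \<mu> K \<psi> f)
          (functional_gradient \<psi> (K f) \<rho>\<^sub>0 v\<^sub>0)))\<^sup>2"


section \<open>The estimators\<close>

text \<open>
  Samples are indexed from 0, so \<open>X i\<close> and \<open>Y i\<close> are the \<open>(i+1)\<close>-st observations and a sample
  of size \<open>n\<close> consists of the indices \<open>i < n\<close>.
\<close>

definition coeff_estimator ::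
  "(nat \<Rightarrow> real) \<Rightarrow> (nat \<Rightarrow> 'x \<Rightarrow> real) \<Rightarrow> (nat \<Rightarrow> 'w \<Rightarrow> 'x) \<Rightarrow> (nat \<Rightarrow> 'w \<Rightarrow> real) \<Rightarrow>
     nat \<Rightarrow> nat \<Rightarrow> 'w \<Rightarrow> real" where
  "coeff_estimator \<rho> \<phi>V X Y n k \<omega> =
     1 / real n * (\<Sum>i<n. 1 / \<rho> k * Y i \<omega> * \<phi>V k (X i \<omega>))"

definition series_estimator ::
  "(nat \<Rightarrow> 'z \<Rightarrow> real) \<Rightarrow> (nat \<Rightarrow> real) \<Rightarrow> (nat \<Rightarrow> 'x \<Rightarrow> real) \<Rightarrow>
     (nat \<Rightarrow> 'w \<Rightarrow> 'x) \<Rightarrow> (nat \<Rightarrow> 'w \<Rightarrow> real) \<Rightarrow> nat \<Rightarrow> nat \<Rightarrow> 'w \<Rightarrow> 'z \<Rightarrow> real" where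
  "series_estimator \<phi> \<rho> \<phi>V X Y n m \<omega> z = (\<Sum>k\<le>m. coeff_estimator \<rho> \<phi>V X Y n k \<omega> * \<phi> k z)"

definition one_step_estimator ::
  "'z measure \<Rightarrow> (('z \<Rightarrow> real) \<Rightarrow> ('x \<Rightarrow> real)) \<Rightarrow> (nat \<Rightarrow> 'z \<Rightarrow> real) \<Rightarrow> (nat \<Rightarrow> real) \<Rightarrow>
     (nat \<Rightarrow> 'x \<Rightarrow> real) \<Rightarrow> (real \<Rightarrow> real) \<Rightarrow> (nat \<Rightarrow> nat) \<Rightarrow>
     (nat \<Rightarrow> 'w \<Rightarrow> 'x) \<Rightarrow> (nat \<Rightarrow> 'w \<Rightarrow> real) \<Rightarrow> nat \<Rightarrow> 'w \<Rightarrow> real" where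
  "one_step_estimator \<nu> K \<phi> \<rho> \<phi>V \<psi> m X Y n \<omega> =
     coeff_estimator \<rho> \<phi>V X Y n 0 \<omega> +
     1 / real n * (\<Sum>i<n. 1 / (\<rho> 0 * fisher_information \<psi>) *
        score \<psi> (Y i \<omega> -
          span_version \<nu> \<phi> (m n) K (series_estimator \<phi> \<rho> \<phi>V X Y n (m n) \<omega>) (X i \<omega>)) *
        \<phi>V 0 (X i \<omega>))"

text \<open>
  Independence of two random variables with values in different types (the library's
  \<open>indep_var\<close> needs a common type). The preimages already form sigma-algebras.
\<close>

definition indep_rvs ::
  "'w measure \<Rightarrow> 'a measure \<Rightarrow> ('w \<Rightarrow> 'a) \<Rightarrow> 'b measure \<Rightarrow> ('w \<Rightarrow> 'b) \<Rightarrow> bool" where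
  "indep_rvs P M A N B \<longleftrightarrow>
     A \<in> measurable P M \<and> B \<in> measurable P N \<and>
     prob_space.indep_set P {A -` S \<inter> space P | S. S \<in> sets M} {B -` S \<inter> space P | S. S \<in> sets N}"

text \<open>The second parameter is the variance.\<close>

definition Normal :: "real \<Rightarrow> real \<Rightarrow> real measure" where
  "Normal a v = density lborel (\<lambda>x. ennreal (normal_density a (sqrt v) x))"

definition converges_in_distribution ::
  "'w measure \<Rightarrow> (nat \<Rightarrow> 'w \<Rightarrow> real) \<Rightarrow> real measure \<Rightarrow> bool" where
  "converges_in_distribution P T D \<longleftrightarrow>
     (\<forall>n. T n \<in> borel_measurable P) \<and> weak_conv_m (\<lambda>n. distr P borel (T n)) D"

definition asymptotically_efficient ::
  "'w measure \<Rightarrow> (nat \<Rightarrow> 'w \<Rightarrow> real) \<Rightarrow> real \<Rightarrow> real \<Rightarrow> bool" where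
  "asymptotically_efficient P \<theta>hat \<theta> v \<longleftrightarrow>
     converges_in_distribution P (\<lambda>n \<omega>. sqrt (real n) * (\<theta>hat n \<omega> - \<theta>)) (Normal 0 v)"

end

theory Submission
  imports Defs
begin

text \<open>
  Write \<open>w\<^sub>k = V \<phi>\<^sub>k\<close>, \<open>a\<^sub>k = \<rho>\<^sub>k f\<^sub>k\<close> and \<open>g = K f = \<Sum> a\<^sub>k w\<^sub>k\<close>, so that the problem becomes a regression
  with orthonormal, uniformly bounded \<open>w\<^sub>k\<close>. Expanding the score around the errors, the linear term
  of the correction cancels the error of the initial estimator of \<open>a\<^sub>0\<close> up to products of two
  centred averages (of order \<open>m / \<surd>n\<close> in mean) and a truncation term; the quadratic term is
  controlled by the empirical Gram matrix, which is close to the identity in Frobenius norm because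
  \<open>m\<^sup>2 / n \<rightarrow> 0\<close>. What remains is the average of \<open>\<Lambda>(\<epsilon>) w\<^sub>0(X) / I(\<psi>)\<close>, to which the central limit
  theorem applies. All remainders are measured by \<open>E min(1, \<bar>\<cdot>\<bar>)\<close>, which is sub-additive and also
  handles products. The projection of the gradient is the tangent vector in the direction
  \<open>4 / (\<rho>\<^sub>0 I(\<psi>)) w\<^sub>0\<close>, because \<open>\<integral> y \<psi>'(y) dy = -1\<close>.
\<close>

section \<open>Analytic preliminaries\<close>

text \<open>The factors \<open>1 / \<rho> k\<close> make the inverse problem ill-posed, but the
  fitted series enters only through \<open>K\<close>, which multiplies \<open>\<phi> k\<close> by
  \<open>\<rho> k\<close>. Working with a_k instead of f_k cancels these factors, and only
  \<open>\<rho> 0\<close> survives. The obstacle is that coefficient errors, score averages and Gram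
  matrix come from one sample, so products of them do not factor under the expectation, and the
  errors have only second moments. Bilinear terms are therefore split by 2|xy| \<le> x^2 + y^2 into
  squares whose means are of order 1/n uniformly in k, since the w_k are uniformly bounded; m + 1 of
  them times \<surd>n give m / \<surd>n. The truncation bias is orthogonal to w_0, so in the linear
  term only its fluctuation counts; in the quadratic term it appears squared, which is why \<surd>n
  times the squared tail must vanish. I(\<psi>) has three roles: as E \<Lambda>' it is the slope
  that makes the cancellation exact, as E \<Lambda>^2 the variance in the limit theorem, and a
  quarter of it is the squared norm of the derivative of \<surd>\<psi>, which fixes the
  projection.\<close>

lemma (in pair_sigma_finite) has_bochner_integral_product_fiber:
  fixes u :: "'a \<Rightarrow> real" and q :: "'a \<Rightarrow> 'b \<Rightarrow> real"
  assumes [measurable]: "(\<lambda>(x, y). q x y) \<in> borel_measurable (M1 \<Otimes>\<^sub>M M2)"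
    and u: "integrable M1 u"
    and q: "\<And>x. x \<in> space M1 \<Longrightarrow> integrable M2 (q x)"
      "\<And>x. x \<in> space M1 \<Longrightarrow> (\<integral>y. q x y \<partial>M2) = A"
      "\<And>x. x \<in> space M1 \<Longrightarrow> (\<integral>y. \<bar>q x y\<bar> \<partial>M2) = B"
  shows "has_bochner_integral (M1 \<Otimes>\<^sub>M M2) (\<lambda>(x, y). u x * q x y) ((\<integral>x. u x \<partial>M1) * A)"
proof -
  have [measurable]: "u \<in> borel_measurable M1" using u by simp
  have int: "integrable (M1 \<Otimes>\<^sub>M M2) (\<lambda>(x, y). u x * q x y)"
  proof (rule Fubini_integrable)
    \<comment> \<open>A common value \<open>B\<close> of the fibre norms reduces the iterated
      absolute integral to that of \<open>u\<close>. In the applications the fibres are translates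
      of one function, so \<open>A\<close> and \<open>B\<close> come from translation
      invariance.\<close>
    have "integrable M1 (\<lambda>x. \<bar>u x\<bar> * B)" using u by simp
    then show "integrable M1 (\<lambda>x. \<integral>y. norm (case (x, y) of (x, y) \<Rightarrow> u x * q x y) \<partial>M2)"
      by (rule Bochner_Integration.integrable_cong[THEN iffD1, rotated -1])
        (auto simp: abs_mult q)
  qed (use q in auto)
  have "(\<integral>x. (\<integral>y. u x * q x y \<partial>M2) \<partial>M1) = (\<integral>x. u x * A \<partial>M1)"
    by (rule Bochner_Integration.integral_cong) (auto simp: q)
  with integral_fst'[OF int] int show ?thesis
    by (simp add: has_bochner_integral_iff)
qed

lemma (in pair_sigma_finite) has_bochner_integral_product:
  fixes u :: "'a \<Rightarrow> real" and v :: "'b \<Rightarrow> real"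
  assumes "integrable M1 u" "integrable M2 v"
  shows "has_bochner_integral (M1 \<Otimes>\<^sub>M M2) (\<lambda>(x, y). u x * v y) ((\<integral>x. u x \<partial>M1) * (\<integral>y. v y \<partial>M2))"
proof -
  have [measurable]: "v \<in> borel_measurable M2" using assms by simp
  show ?thesis using assms by (intro has_bochner_integral_product_fiber) auto
qed

text \<open>Integrate \<open>F' (x + s)\<close> over \<open>x \<in> \<real>\<close> and \<open>s \<in> [0, 1]\<close> in both orders.\<close>

lemma integral_deriv_eq_0:
  fixes F F' :: "real \<Rightarrow> real"
  assumes F: "integrable lborel F" and F': "integrable lborel F'"
    and der: "\<And>x. (F has_real_derivative F' x) (at x)" and cont: "continuous_on UNIV F'"
  shows "(\<integral>x. F' x \<partial>lborel) = 0"
proof -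
  have [measurable]: "F' \<in> borel_measurable borel" using F' by simp
  let ?u = "indicator {0..1} :: real \<Rightarrow> real"
  have shift: "integrable lborel (\<lambda>x. h (s + x))" "(\<integral>x. h (s + x) \<partial>lborel) = (\<integral>x. h x \<partial>lborel)"
    if "integrable lborel h" for h :: "real \<Rightarrow> real" and s
    using lborel_integrable_real_affine[OF that, of 1 s] lborel_integral_real_affine[of 1 h s] by auto
  have "integrable lborel (\<lambda>x. \<bar>F' x\<bar>)" using F' by simp
  note shift_abs = shift[OF this]
  have *: "has_bochner_integral (lborel \<Otimes>\<^sub>M lborel) (\<lambda>(s, x). ?u s * F' (s + x))
      ((\<integral>s. ?u s \<partial>lborel) * (\<integral>x. F' x \<partial>lborel))"
    by (rule lborel_pair.has_bochner_integral_product_fiber[where B = "\<integral>x. \<bar>F' x\<bar> \<partial>lborel"])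
      (auto simp: shift[OF F'] shift_abs integrable_indicator_iff)
  then have int: "integrable (lborel \<Otimes>\<^sub>M lborel) (\<lambda>(s, x). ?u s * F' (s + x))"
    and val: "(\<integral>z. (case z of (s, x) \<Rightarrow> ?u s * F' (s + x)) \<partial>(lborel \<Otimes>\<^sub>M lborel)) = (\<integral>x. F' x \<partial>lborel)"
    by (auto simp: has_bochner_integral_iff)
  \<comment> \<open>Over a unit interval the fundamental theorem gives a difference of two
    translates of \<open>F\<close>, whose integrals agree. This avoids any discussion of the limits
    of \<open>F\<close> at infinity.\<close>
  have inner: "(\<integral>s. ?u s * F' (s + x) \<partial>lborel) = F (1 + x) - F (0 + x)" for x
  proof -
    have "has_bochner_integral lborel (\<lambda>s. F' (s + x) * indicator {0..1} s) (F (1 + x) - F (0 + x))"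
    proof (rule has_bochner_integral_FTC_Icc_real)
      fix s :: real
      show "DERIV (\<lambda>s. F (s + x)) s :> F' (s + x)"
        using der[of "s + x"] by (simp add: DERIV_shift)
      have "isCont F' (s + x)" using cont by (simp add: continuous_on_eq_continuous_at)
      then show "isCont (\<lambda>s. F' (s + x)) s"
        using isCont_o2[of s "\<lambda>s. s + x" F'] by simp
    qed simp
    then show ?thesis by (simp add: has_bochner_integral_iff mult.commute)
  qed
  have "(\<integral>z. (case z of (s, x) \<Rightarrow> ?u s * F' (s + x)) \<partial>(lborel \<Otimes>\<^sub>M lborel))
      = (\<integral>x. (\<integral>s. ?u s * F' (s + x) \<partial>lborel) \<partial>lborel)"
    using lborel_pair.integral_snd[of "\<lambda>s x. ?u s * F' (s + x)"] int by simp
  also have "\<dots> = (\<integral>x. F (1 + x) \<partial>lborel) - (\<integral>x. F (0 + x) \<partial>lborel)"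
    unfolding inner by (rule Bochner_Integration.integral_diff) (use shift[OF F, of 1] F in auto)
  also have "\<dots> = 0" using shift[OF F, of 1] by simp
  finally show ?thesis using val by simp
qed

text \<open>The second derivative need not be continuous, so the mean value bound is used twice: it
  makes \<open>deriv L\<close> Lipschitz, and is then applied to \<open>L y - deriv L e * y\<close>
  on the segment. The price is \<open>C\<close> in place of C/2.\<close>

lemma Taylor_quadratic_bound:
  fixes L :: "real \<Rightarrow> real"
  assumes L: "\<And>y. L differentiable at y" "\<And>y. deriv L differentiable at y"
    and C: "\<And>y. \<bar>deriv (deriv L) y\<bar> \<le> C"
  shows "\<bar>L (e + d) - L e - deriv L e * d\<bar> \<le> C * d\<^sup>2"
proof -
  have D: "(L has_real_derivative deriv L y) (at y)"
      "(deriv L has_real_derivative deriv (deriv L) y) (at y)" for y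
    using L[of y] by (simp_all add: DERIV_deriv_iff_real_differentiable)
  have lip: "\<bar>deriv L y - deriv L e\<bar> \<le> C * \<bar>y - e\<bar>" for y
    using field_differentiable_bound[of UNIV "deriv L" "deriv (deriv L)" C y e] D(2) C by auto
  have C0: "0 \<le> C" using C[of 0] by linarith
  have "norm ((L (e + d) - deriv L e * (e + d)) - (L e - deriv L e * e)) \<le> (C * \<bar>d\<bar>) * norm (e + d - e)"
  proof (rule field_differentiable_bound[of "closed_segment e (e + d)"])
    fix y assume y: "y \<in> closed_segment e (e + d)"
    show "((\<lambda>y. L y - deriv L e * y) has_field_derivative (deriv L y - deriv L e))
        (at y within closed_segment e (e + d))"
      by (rule has_field_derivative_at_within) (auto intro!: derivative_eq_intros D)
    have "\<bar>y - e\<bar> \<le> \<bar>d\<bar>" using y by (auto simp: closed_segment_eq_real_ivl split: if_splits)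
    then show "norm (deriv L y - deriv L e) \<le> C * \<bar>d\<bar>"
      using lip[of y] C0 by (smt (verit) mult_left_mono real_norm_def)
  qed auto
  then show ?thesis by (simp add: algebra_simps power2_eq_square)
qed

section \<open>Sums of independent identically distributed variables\<close>

text \<open>\<open>D\<close> serves both as the target sigma-algebra and as the common law, so
  moments of the sample are integrals over \<open>D\<close>.\<close>

locale iid_sample = prob_space P for P :: "'w measure" +
  fixes Z :: "nat \<Rightarrow> 'w \<Rightarrow> 'a" and D :: "'a measure"
  assumes indep: "indep_vars (\<lambda>_. D) Z UNIV"
    and law: "\<And>i. distr P D (Z i) = D"
begin

lemma Z_measurable [measurable]: "Z i \<in> measurable P D"
  using indep by (simp add: indep_vars_def2)

lemma law_prob_space: "prob_space D"
  using prob_space_distr[OF Z_measurable[of 0]] by (simp add: law)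

lemma integrable_sample:
  fixes F :: "'a \<Rightarrow> real"
  shows "integrable D F \<Longrightarrow> integrable P (\<lambda>w. F (Z i w))"
  using integrable_distr[OF Z_measurable[of i], of F] by (simp add: law)

lemma expectation_sample:
  fixes F :: "'a \<Rightarrow> real"
  shows "F \<in> borel_measurable D \<Longrightarrow> expectation (\<lambda>w. F (Z i w)) = (\<integral>z. F z \<partial>D)"
  using integral_distr[OF Z_measurable[of i], of F] by (simp add: law)

lemma AE_sample: "(AE z in D. A z) \<Longrightarrow> AE w in P. A (Z i w)"
  using AE_distrD[OF Z_measurable[of i], where P = A] unfolding law .

lemma integrable_of_square:
  fixes F :: "'a \<Rightarrow> real"
  assumes "F \<in> borel_measurable D" "integrable D (\<lambda>z. (F z)\<^sup>2)"
  shows "integrable D F"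
proof -
  interpret D: prob_space D by (rule law_prob_space)
  show ?thesis using assms by (rule D.square_integrable_imp_integrable)
qed

text \<open>By induction: the new summand is independent of the earlier sum and centred, so the
  cross term has mean zero.\<close>

lemma expectation_sum_square:
  fixes F :: "'a \<Rightarrow> real"
  assumes F[measurable]: "F \<in> borel_measurable D" and F2: "integrable D (\<lambda>z. (F z)\<^sup>2)"
    and F0: "(\<integral>z. F z \<partial>D) = 0"
  shows "has_bochner_integral P (\<lambda>w. (\<Sum>i<n. F (Z i w))\<^sup>2) (real n * (\<integral>z. (F z)\<^sup>2 \<partial>D))"
proof (induction n)
  case 0
  then show ?case by (simp add: has_bochner_integral_iff)
next
  case (Suc n)
  have indepF: "indep_vars (\<lambda>_. borel) (\<lambda>i w. F (Z i w)) UNIV"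
    by (rule indep_vars_compose2[OF indep]) simp
  have intF: "integrable P (\<lambda>w. F (Z i w))" for i
    by (rule integrable_sample[OF integrable_of_square[OF F F2]])
  have "indep_var borel (\<lambda>w. F (Z n w)) borel (\<lambda>w. \<Sum>i<n. F (Z i w))"
    by (rule indep_vars_sum) (auto intro: indep_vars_subset[OF indepF])
  moreover have "integrable P (\<lambda>w. \<Sum>i<n. F (Z i w))" using intF by simp
  ultimately have "has_bochner_integral P (\<lambda>w. F (Z n w) * (\<Sum>i<n. F (Z i w))) 0"
    using indep_var_integrable[OF _ intF] indep_var_lebesgue_integral[OF _ intF]
    by (simp add: has_bochner_integral_iff expectation_sample F0)
  then have "has_bochner_integral P (\<lambda>w. 2 * (F (Z n w) * (\<Sum>i<n. F (Z i w)))) (2 * 0)"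
    by (intro has_bochner_integral_mult_right) simp
  moreover have "has_bochner_integral P (\<lambda>w. (F (Z n w))\<^sup>2) (\<integral>z. (F z)\<^sup>2 \<partial>D)"
    using integrable_sample[OF F2] expectation_sample[of "\<lambda>z. (F z)\<^sup>2"]
    by (simp add: has_bochner_integral_iff)
  ultimately have "has_bochner_integral P
     (\<lambda>w. (\<Sum>i<n. F (Z i w))\<^sup>2 + 2 * (F (Z n w) * (\<Sum>i<n. F (Z i w))) + (F (Z n w))\<^sup>2)
     (real n * (\<integral>z. (F z)\<^sup>2 \<partial>D) + 2 * 0 + (\<integral>z. (F z)\<^sup>2 \<partial>D))"
    using Suc by (intro has_bochner_integral_add)
  then show ?case
    by (simp add: power2_sum algebra_simps)
qed

end

section \<open>Weak convergence through characteristic functions\<close>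

lemma cmod_iexp_diff_le: "cmod (iexp (t * x) - iexp (t * y)) \<le> (2 + \<bar>t\<bar>) * min 1 \<bar>x - y\<bar>"
proof -
  have "iexp (t * x) - iexp (t * y) = iexp (t * y) * (iexp (t * (x - y)) - 1)"
    by (simp add: algebra_simps exp_add[symmetric] flip: of_real_mult)
  then have eq: "cmod (iexp (t * x) - iexp (t * y)) = cmod (iexp (t * (x - y)) - 1)"
    by (simp add: norm_mult)
  \<comment> \<open>This Lipschitz bound serves for close points and the trivial bound 2 for distant
    ones; the factor \<open>2 + \<bar>t\<bar>\<close> dominates both.\<close>
  have "cmod (iexp (t * (x - y)) - 1) \<le> \<bar>t\<bar> * \<bar>x - y\<bar>"
    using iexp_approx1[of "t * (x - y)" 0] by (simp add: abs_mult)
  moreover have "cmod (iexp (t * (x - y)) - 1) \<le> 2"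
    using norm_triangle_ineq4[of "iexp (t * (x - y))" 1] by simp
  ultimately have "cmod (iexp (t * (x - y)) - 1) \<le> (2 + \<bar>t\<bar>) * min 1 \<bar>x - y\<bar>"
    by (smt (verit, best) abs_ge_zero min_def mult_nonneg_nonneg distrib_right mult_cancel_left2)
  then show ?thesis unfolding eq .
qed

text \<open>A form of Slutsky's theorem: the truncated distance bounds the difference of the
  characteristic functions at every fixed \<open>t\<close>, and Levy's continuity theorem returns to
  weak convergence.\<close>

lemma (in prob_space) weak_conv_m_perturbation:
  fixes S T :: "nat \<Rightarrow> 'a \<Rightarrow> real"
  assumes [measurable]: "\<And>n. S n \<in> borel_measurable M" "\<And>n. T n \<in> borel_measurable M"
    and L: "real_distribution L" and conv: "weak_conv_m (\<lambda>n. distr M borel (S n)) L"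
    and diff: "(\<lambda>n. expectation (\<lambda>w. min 1 \<bar>T n w - S n w\<bar>)) \<longlonglongrightarrow> 0"
  shows "weak_conv_m (\<lambda>n. distr M borel (T n)) L"
proof (rule levy_continuity[OF _ L])
  show "real_distribution (distr M borel (T n))" for n
    by (rule real_distribution_distr) simp
  fix t
  have char: "char (distr M borel U) t = expectation (\<lambda>w. iexp (t * U w))"
    if [measurable]: "U \<in> borel_measurable M" for U
    unfolding char_def by (subst integral_distr) auto
  have int: "integrable M (\<lambda>w. iexp (t * U w))" if [measurable]: "U \<in> borel_measurable M" for U
    by (rule integrable_const_bound[of _ 1]) auto
  have "cmod (char (distr M borel (T n)) t - char (distr M borel (S n)) t)
      \<le> (2 + \<bar>t\<bar>) * expectation (\<lambda>w. min 1 \<bar>T n w - S n w\<bar>)" for n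
  proof -
    have "char (distr M borel (T n)) t - char (distr M borel (S n)) t
        = expectation (\<lambda>w. iexp (t * T n w) - iexp (t * S n w))"
      by (simp add: char int del: of_real_mult)
    also have "cmod \<dots> \<le> expectation (\<lambda>w. cmod (iexp (t * T n w) - iexp (t * S n w)))"
      by (rule integral_norm_bound)
    also have "\<dots> \<le> expectation (\<lambda>w. (2 + \<bar>t\<bar>) * min 1 \<bar>T n w - S n w\<bar>)"
      by (intro integral_mono cmod_iexp_diff_le integrable_norm Bochner_Integration.integrable_diff int
          integrable_mult_right integrable_const_bound[of _ 1]) auto
    finally show ?thesis by simp
  qed
  then have "\<forall>\<^sub>F n in sequentially. cmod (char (distr M borel (T n)) t - char (distr M borel (S n)) t)
      \<le> (2 + \<bar>t\<bar>) * expectation (\<lambda>w. min 1 \<bar>T n w - S n w\<bar>)"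
    by simp
  moreover have "(\<lambda>n. (2 + \<bar>t\<bar>) * expectation (\<lambda>w. min 1 \<bar>T n w - S n w\<bar>)) \<longlonglongrightarrow> 0"
    using tendsto_mult_left[OF diff, of "2 + \<bar>t\<bar>"] by simp
  ultimately have "(\<lambda>n. char (distr M borel (T n)) t - char (distr M borel (S n)) t) \<longlonglongrightarrow> 0"
    by (rule Lim_null_comparison)
  moreover have "(\<lambda>n. char (distr M borel (S n)) t) \<longlonglongrightarrow> char L t"
    by (rule levy_continuity1[OF _ L conv]) (rule real_distribution_distr, simp)
  ultimately have "(\<lambda>n. (char (distr M borel (T n)) t - char (distr M borel (S n)) t)
      + char (distr M borel (S n)) t) \<longlonglongrightarrow> 0 + char L t"
    by (rule tendsto_add)
  then show "(\<lambda>n. char (distr M borel (T n)) t) \<longlonglongrightarrow> char L t"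
    by simp
qed

lemma (in prob_space) weak_conv_m_scale:
  assumes [measurable]: "\<And>n. S n \<in> borel_measurable M"
    and L: "real_distribution L" and conv: "weak_conv_m (\<lambda>n. distr M borel (S n)) L"
  shows "weak_conv_m (\<lambda>n. distr M borel (\<lambda>w. c * S n w)) (distr L borel (\<lambda>x. c * x))"
proof -
  interpret L: real_distribution L by (rule L)
  have char: "char (distr N borel (\<lambda>w. c * U w)) t = char (distr N borel U) (c * t)"
    if [measurable]: "U \<in> borel_measurable N" for N :: "'c measure" and U t
    unfolding char_def by (subst (1 2) integral_distr) (auto simp: mult_ac)
  have dL: "char (distr L borel (\<lambda>x. c * x)) t = char L (c * t)" for t
    unfolding char_def by (subst integral_distr) (auto simp: mult_ac)
  show ?thesis
  proof (rule levy_continuity)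
    show "real_distribution (distr M borel (\<lambda>w. c * S n w))" for n
      by (rule real_distribution_distr) simp
    show "real_distribution (distr L borel (\<lambda>x. c * x))"
      by (rule L.real_distribution_distr) simp
    show "(\<lambda>n. char (distr M borel (\<lambda>w. c * S n w)) t) \<longlonglongrightarrow> char (distr L borel (\<lambda>x. c * x)) t" for t
      unfolding dL by (subst char) (auto intro!: levy_continuity1[OF _ L conv] real_distribution_distr)
  qed
qed

lemma Normal_0_eq_distr:
  assumes "0 < v"
  shows "Normal 0 v = distr std_normal_distribution borel (\<lambda>x. sqrt v * x)"
proof -
  interpret N: prob_space std_normal_distribution
    by (rule prob_space_normal_density) simp
  have "distributed std_normal_distribution lborel (\<lambda>x. x) std_normal_density"
    by (simp add: distributed_def distr_id2)
  from N.normal_density_affine[OF this, of "sqrt v" 0] assms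
  have "distributed std_normal_distribution lborel (\<lambda>x. sqrt v * x) (normal_density 0 (sqrt v))"
    by simp
  then have "distr std_normal_distribution lborel (\<lambda>x. sqrt v * x) = Normal 0 v"
    by (simp add: distributed_def Normal_def)
  then show ?thesis by (simp cong: distr_cong)
qed

lemma (in iid_sample) central_limit_theorem_scaled:
  fixes F :: "'a \<Rightarrow> real"
  assumes F[measurable]: "F \<in> borel_measurable D" and F2: "integrable D (\<lambda>z. (F z)\<^sup>2)"
    and F0: "(\<integral>z. F z \<partial>D) = 0" and v: "(\<integral>z. (F z)\<^sup>2 \<partial>D) = v" "0 < v"
  shows "weak_conv_m (\<lambda>n. distr P borel (\<lambda>w. c * ((\<Sum>i<n. F (Z i w)) / sqrt (real n))))
      (distr std_normal_distribution borel (\<lambda>x. c * sqrt v * x))"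
proof -
  have mean: "expectation (\<lambda>w. F (Z i w)) = 0" for i
    by (simp add: expectation_sample F0)
  have sq: "integrable P (\<lambda>w. (F (Z i w))\<^sup>2)" "expectation (\<lambda>w. (F (Z i w))\<^sup>2) = v" for i
    using integrable_sample[OF F2] expectation_sample[of "\<lambda>z. (F z)\<^sup>2"] v by simp_all
  have "distr P borel (\<lambda>w. F (Z i w)) = distr D borel F" for i
    using distr_distr[OF F Z_measurable[of i]] by (simp add: law comp_def)
  then have "weak_conv_m (\<lambda>n. distr P borel (\<lambda>w. (\<Sum>i<n. F (Z i w)) / sqrt (n * (sqrt v)\<^sup>2)))
      std_normal_distribution"
    using v mean sq
    by (intro central_limit_theorem_zero_mean indep_vars_compose2[OF indep]) auto
  \<comment> \<open>The limit theorem above normalises by the standard deviation as well; the factor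
    \<open>sqrt v\<close> undoes this and leaves division by \<open>sqrt (real n)\<close>
    alone.\<close>
  from weak_conv_m_scale[OF _ real_dist_normal_dist this, of "c * sqrt v"] v(2)
  show ?thesis by (simp add: real_sqrt_mult)
qed

section \<open>Expansion of the one-step correction\<close>

text \<open>Cauchy-Schwarz on pairs (k, l): the array of products \<open>b k * b l\<close> has
  Euclidean norm equal to the squared norm of \<open>b\<close>. Thus the Frobenius norm dominates
  the quadratic form, without any spectral argument.\<close>

lemma quadratic_form_le:
  fixes b :: "'i \<Rightarrow> real" and G :: "'i \<Rightarrow> 'i \<Rightarrow> real"
  shows "(\<Sum>k\<in>A. \<Sum>l\<in>A. b k * b l * G k l)
    \<le> (\<Sum>k\<in>A. (b k)\<^sup>2) * sqrt (\<Sum>k\<in>A. \<Sum>l\<in>A. (G k l)\<^sup>2)"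
proof -
  let ?f = "\<lambda>(k, l). b k * b l" and ?g = "\<lambda>(k, l). G k l"
  have "(\<Sum>k\<in>A. \<Sum>l\<in>A. b k * b l * G k l) = (\<Sum>p\<in>A \<times> A. ?f p * ?g p)"
    by (simp add: sum.cartesian_product split_def)
  also have "\<dots> \<le> (\<Sum>p\<in>A \<times> A. \<bar>?f p\<bar> * \<bar>?g p\<bar>)"
    by (intro sum_mono) (auto simp: abs_mult[symmetric])
  also have "\<dots> \<le> L2_set ?f (A \<times> A) * L2_set ?g (A \<times> A)"
    by (rule L2_set_mult_ineq)
  also have "L2_set ?f (A \<times> A) = (\<Sum>k\<in>A. (b k)\<^sup>2)"
  proof -
    have "(\<Sum>p\<in>A \<times> A. (?f p)\<^sup>2) = (\<Sum>k\<in>A. (b k)\<^sup>2)\<^sup>2"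
      by (simp add: power2_eq_square[of "sum _ _"] sum_product sum.cartesian_product split_def
          power_mult_distrib)
    then show ?thesis by (simp add: L2_set_def sum_nonneg)
  qed
  also have "L2_set ?g (A \<times> A) = sqrt (\<Sum>k\<in>A. \<Sum>l\<in>A. (G k l)\<^sup>2)"
    by (simp add: L2_set_def sum.cartesian_product split_def)
  finally show ?thesis .
qed

definition avg :: "nat \<Rightarrow> (nat \<Rightarrow> real) \<Rightarrow> real" where
  "avg n f = (\<Sum>i<n. f i) / real n"

lemma avg_add: "avg n (\<lambda>i. f i + h i) = avg n f + avg n h"
  by (simp add: avg_def sum.distrib add_divide_distrib)

lemma avg_cmult: "avg n (\<lambda>i. c * f i) = c * avg n f"
  by (simp add: avg_def sum_distrib_left)

lemma avg_sum: "avg n (\<lambda>i. \<Sum>k\<in>A. f k i) = (\<Sum>k\<in>A. avg n (f k))"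
  by (simp add: avg_def sum_divide_distrib) (rule sum.swap)

lemma avg_mono: "(\<And>i. i < n \<Longrightarrow> f i \<le> h i) \<Longrightarrow> avg n f \<le> avg n h"
  by (auto simp: avg_def intro!: sum_mono divide_right_mono)

lemma avg_nonneg: "(\<And>i. i < n \<Longrightarrow> 0 \<le> f i) \<Longrightarrow> 0 \<le> avg n f"
  by (auto simp: avg_def intro!: sum_nonneg divide_nonneg_nonneg)

lemma abs_avg_le: "\<bar>avg n f\<bar> \<le> avg n (\<lambda>i. \<bar>f i\<bar>)"
  by (simp add: avg_def divide_right_mono)

text \<open>The left side is the quadratic form of the empirical Gram matrix at \<open>b\<close>.
  Writing that matrix as identity plus error yields the summand 1 and the Frobenius norm of the
  error.\<close>

lemma avg_square_lincomb_le:
  fixes v :: "'k \<Rightarrow> nat \<Rightarrow> real"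
  assumes "finite A"
  shows "avg n (\<lambda>i. (\<Sum>k\<in>A. b k * v k i)\<^sup>2)
    \<le> (\<Sum>k\<in>A. (b k)\<^sup>2) *
      (1 + sqrt (\<Sum>k\<in>A. \<Sum>l\<in>A. (avg n (\<lambda>i. v k i * v l i) - (if k = l then 1 else 0))\<^sup>2))"
proof -
  let ?G = "\<lambda>k l. avg n (\<lambda>i. v k i * v l i) - (if k = l then 1 else 0)"
  have "avg n (\<lambda>i. (\<Sum>k\<in>A. b k * v k i)\<^sup>2)
      = avg n (\<lambda>i. \<Sum>k\<in>A. \<Sum>l\<in>A. b k * b l * (v k i * v l i))"
    by (simp add: power2_eq_square sum_product mult_ac)
  also have "\<dots> = (\<Sum>k\<in>A. \<Sum>l\<in>A. b k * b l * avg n (\<lambda>i. v k i * v l i))"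
    by (simp add: avg_sum avg_cmult)
  also have "\<dots> = (\<Sum>k\<in>A. \<Sum>l\<in>A. b k * b l * ?G k l + (if l = k then b k * b l else 0))"
    by (intro sum.cong refl) (auto simp: algebra_simps)
  also have "\<dots> = (\<Sum>k\<in>A. \<Sum>l\<in>A. b k * b l * ?G k l) + (\<Sum>k\<in>A. (b k)\<^sup>2)"
    using assms by (simp add: sum.distrib power2_eq_square)
  finally show ?thesis
    using quadratic_form_le[where b = b and G = ?G and A = A] by (simp add: distrib_left)
qed

text \<open>
  In the linearised correction the term \<open>k = 0\<close> contributes \<open>I b\<^sub>0\<close> and cancels the error of \<open>ahat 0\<close>.
\<close>

lemma one_step_expansion:
  fixes L L' :: "real \<Rightarrow> real" and w :: "nat \<Rightarrow> nat \<Rightarrow> real" and a ahat :: "nat \<Rightarrow> real" and g e :: "nat \<Rightarrow> real"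
    and n m :: nat
  assumes Taylor: "\<And>e d. \<bar>L (e + d) - L e - L' e * d\<bar> \<le> C * d\<^sup>2"
    and w0: "\<And>i. i < n \<Longrightarrow> \<bar>w 0 i\<bar> \<le> B" and I: "0 < I" and n: "0 < n"
  defines "b \<equiv> \<lambda>k. a k - ahat k" and "r \<equiv> \<lambda>i. g i - (\<Sum>k\<le>m. a k * w k i)"
  defines "s \<equiv> \<Sum>k\<le>m. (b k)\<^sup>2"
    and "F \<equiv> \<Sum>k\<le>m. \<Sum>l\<le>m. (avg n (\<lambda>i. w k i * w l i) - (if k = l then 1 else 0))\<^sup>2"
  shows "\<bar>ahat 0 + avg n (\<lambda>i. 1 / I * L (g i + e i - (\<Sum>k\<le>m. ahat k * w k i)) * w 0 i) - a 0
      - 1 / I * avg n (\<lambda>i. L (e i) * w 0 i)\<bar>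
    \<le> 1 / I * (\<bar>\<Sum>k\<le>m. b k * (avg n (\<lambda>i. L' (e i) * (w k i * w 0 i)) - (if k = 0 then I else 0))\<bar>
        + \<bar>avg n (\<lambda>i. L' (e i) * (r i * w 0 i))\<bar>
        + 2 * C * B * (avg n (\<lambda>i. (r i)\<^sup>2) + s * (1 + sqrt F)))"
proof -
  \<comment> \<open>\<open>D i\<close> is the error of the fitted regression function at the i-th
    point: truncation remainder plus coefficient error. The argument of the score is then
    \<open>e i + D i\<close>.\<close>
  define D where "D = (\<lambda>i. r i + (\<Sum>k\<le>m. b k * w k i))"
  define q where "q = (\<lambda>i. L (e i + D i) - L (e i) - L' (e i) * D i)"
  define H where "H = (\<lambda>k. avg n (\<lambda>i. L' (e i) * (w k i * w 0 i)) - (if k = 0 then I else 0))"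
  define R where "R = avg n (\<lambda>i. L' (e i) * (r i * w 0 i))"
  define U where "U = avg n (\<lambda>i. L (e i) * w 0 i)"
  define T where "T = avg n (\<lambda>i. L (g i + e i - (\<Sum>k\<le>m. ahat k * w k i)) * w 0 i)"
  have D: "g i + e i - (\<Sum>k\<le>m. ahat k * w k i) = e i + D i" for i
    by (simp add: D_def r_def b_def sum_subtractf left_diff_distrib)
  have "T = avg n (\<lambda>i. L (e i) * w 0 i + L' (e i) * (r i * w 0 i)
      + (\<Sum>k\<le>m. b k * (L' (e i) * (w k i * w 0 i))) + q i * w 0 i)"
    unfolding T_def D by (rule arg_cong[where f = "avg n"])
      (simp add: fun_eq_iff q_def D_def algebra_simps sum_distrib_left sum_distrib_right)
  also have "\<dots> = U + R + (\<Sum>k\<le>m. b k * avg n (\<lambda>i. L' (e i) * (w k i * w 0 i))) + avg n (\<lambda>i. q i * w 0 i)"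
    by (simp add: avg_add avg_sum avg_cmult U_def R_def)
  \<comment> \<open>\<open>I\<close> is split off at k = 0 because it will be the mean of that
    average; \<open>H k\<close> is the centred rest. After division by \<open>I\<close>, the summand
    \<open>b 0 * I\<close> offsets \<open>ahat 0 - a 0 = - b 0\<close>.\<close>
  also have "(\<Sum>k\<le>m. b k * avg n (\<lambda>i. L' (e i) * (w k i * w 0 i))) = (\<Sum>k\<le>m. b k * H k + (if k = 0 then b k * I else 0))"
    by (intro sum.cong refl) (auto simp: H_def algebra_simps)
  also have "\<dots> = (\<Sum>k\<le>m. b k * H k) + b 0 * I"
    by (simp add: sum.distrib)
  finally have T: "T = U + R + ((\<Sum>k\<le>m. b k * H k) + b 0 * I) + avg n (\<lambda>i. q i * w 0 i)" .
  have C: "0 \<le> C" using Taylor[of 0 1] by (smt (verit) mult_cancel_left1 one_power2 power2_eq_square mult.right_neutral)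
  have "\<bar>avg n (\<lambda>i. q i * w 0 i)\<bar> \<le> avg n (\<lambda>i. 2 * C * B * ((r i)\<^sup>2 + (\<Sum>k\<le>m. b k * w k i)\<^sup>2))"
  proof (rule order_trans[OF abs_avg_le avg_mono])
    fix i assume i: "i < n"
    have "\<bar>q i * w 0 i\<bar> \<le> (C * (D i)\<^sup>2) * B"
      unfolding abs_mult by (rule mult_mono) (use Taylor w0[OF i] C in \<open>auto simp: q_def\<close>)
    also have "\<dots> \<le> (C * (2 * ((r i)\<^sup>2 + (\<Sum>k\<le>m. b k * w k i)\<^sup>2))) * B"
    proof -
      have "0 \<le> (r i - (\<Sum>k\<le>m. b k * w k i))\<^sup>2" by simp
      then have "(D i)\<^sup>2 \<le> 2 * ((r i)\<^sup>2 + (\<Sum>k\<le>m. b k * w k i)\<^sup>2)"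
        by (simp add: D_def power2_sum power2_diff)
      moreover have "0 \<le> B" using w0[OF i] by linarith
      ultimately show ?thesis using C by (intro mult_right_mono mult_left_mono)
    qed
    finally show "\<bar>q i * w 0 i\<bar> \<le> 2 * C * B * ((r i)\<^sup>2 + (\<Sum>k\<le>m. b k * w k i)\<^sup>2)"
      by (simp add: mult_ac)
  qed
  also have "\<dots> = 2 * C * B * (avg n (\<lambda>i. (r i)\<^sup>2) + avg n (\<lambda>i. (\<Sum>k\<le>m. b k * w k i)\<^sup>2))"
    by (simp add: avg_cmult avg_add)
  also have "\<dots> \<le> 2 * C * B * (avg n (\<lambda>i. (r i)\<^sup>2) + s * (1 + sqrt F))"
    using C w0[OF n] unfolding s_def F_def
    by (intro mult_left_mono add_left_mono avg_square_lincomb_le) auto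
  finally have Q: "\<bar>avg n (\<lambda>i. q i * w 0 i)\<bar> \<le> 2 * C * B * (avg n (\<lambda>i. (r i)\<^sup>2) + s * (1 + sqrt F))" .
  have "ahat 0 + avg n (\<lambda>i. 1 / I * L (g i + e i - (\<Sum>k\<le>m. ahat k * w k i)) * w 0 i) - a 0
      - 1 / I * U = 1 / I * (T - U) - b 0"
    by (simp add: T_def b_def algebra_simps avg_cmult flip: times_divide_eq_left)
  also have "\<dots> = 1 / I * ((\<Sum>k\<le>m. b k * H k) + R + avg n (\<lambda>i. q i * w 0 i))"
    using I by (simp add: T field_simps)
  finally have eq: "ahat 0 + avg n (\<lambda>i. 1 / I * L (g i + e i - (\<Sum>k\<le>m. ahat k * w k i)) * w 0 i) - a 0
      - 1 / I * U = 1 / I * ((\<Sum>k\<le>m. b k * H k) + R + avg n (\<lambda>i. q i * w 0 i))" .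
  have "\<bar>(\<Sum>k\<le>m. b k * H k) + R + avg n (\<lambda>i. q i * w 0 i)\<bar>
      \<le> \<bar>\<Sum>k\<le>m. b k * H k\<bar> + \<bar>R\<bar> + 2 * C * B * (avg n (\<lambda>i. (r i)\<^sup>2) + s * (1 + sqrt F))"
    using Q by linarith
  then have "\<bar>1 / I * ((\<Sum>k\<le>m. b k * H k) + R + avg n (\<lambda>i. q i * w 0 i))\<bar>
      \<le> 1 / I * (\<bar>\<Sum>k\<le>m. b k * H k\<bar> + \<bar>R\<bar> + 2 * C * B * (avg n (\<lambda>i. (r i)\<^sup>2) + s * (1 + sqrt F)))"
    using I by (simp add: divide_right_mono)
  then have "\<bar>ahat 0 + avg n (\<lambda>i. 1 / I * L (g i + e i - (\<Sum>k\<le>m. ahat k * w k i)) * w 0 i) - a 0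
        - 1 / I * U\<bar>
      \<le> 1 / I * (\<bar>\<Sum>k\<le>m. b k * H k\<bar> + \<bar>R\<bar> + 2 * C * B * (avg n (\<lambda>i. (r i)\<^sup>2) + s * (1 + sqrt F)))"
    by (simp only: eq)
  then show ?thesis unfolding U_def R_def H_def .
qed

section \<open>Second moments of centred sample averages\<close>

lemma (in prob_space) expectation_abs_le_sqrt:
  fixes U :: "'a \<Rightarrow> real"
  assumes [measurable]: "U \<in> borel_measurable M" and U2: "integrable M (\<lambda>w. (U w)\<^sup>2)"
  shows "expectation (\<lambda>w. \<bar>U w\<bar>) \<le> sqrt (expectation (\<lambda>w. (U w)\<^sup>2))"
proof -
  have "integrable M (\<lambda>w. \<bar>U w\<bar>)"
    using square_integrable_imp_integrable[OF _ U2] by simp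
  from variance_eq[OF this] U2
  have "(expectation (\<lambda>w. \<bar>U w\<bar>))\<^sup>2 \<le> expectation (\<lambda>w. (U w)\<^sup>2)"
    using variance_positive[of "\<lambda>w. \<bar>U w\<bar>"] by simp
  then show ?thesis by (simp add: real_le_rsqrt)
qed

context iid_sample begin

text \<open>The exact value is the variance divided by n; dropping \<open>- c\<^sup>2\<close> leaves
  a bound by the raw second moment, which is easier to estimate uniformly in the index k.\<close>

lemma avg_centred_square:
  fixes F :: "'a \<Rightarrow> real"
  assumes F[measurable]: "F \<in> borel_measurable D" and F2: "integrable D (\<lambda>z. (F z)\<^sup>2)"
    and c: "(\<integral>z. F z \<partial>D) = c" and n: "0 < n"
  shows "integrable P (\<lambda>w. (avg n (\<lambda>i. F (Z i w)) - c)\<^sup>2)"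
    and "expectation (\<lambda>w. (avg n (\<lambda>i. F (Z i w)) - c)\<^sup>2) \<le> (\<integral>z. (F z)\<^sup>2 \<partial>D) / real n"
proof -
  interpret D: prob_space D by (rule law_prob_space)
  have intF: "integrable D F" by (rule integrable_of_square[OF F F2])
  have sq: "(F z - c)\<^sup>2 = (F z)\<^sup>2 - 2 * c * F z + c\<^sup>2" for z
    by (simp add: power2_diff)
  have int: "integrable D (\<lambda>z. (F z - c)\<^sup>2)" unfolding sq using intF F2 by simp
  have val: "(\<integral>z. (F z - c)\<^sup>2 \<partial>D) = (\<integral>z. (F z)\<^sup>2 \<partial>D) - c\<^sup>2"
    unfolding sq using intF F2 by (simp add: c D.prob_space power2_eq_square)
  have "has_bochner_integral P (\<lambda>w. (\<Sum>i<n. F (Z i w) - c)\<^sup>2) (real n * (\<integral>z. (F z - c)\<^sup>2 \<partial>D))"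
    using int intF by (intro expectation_sum_square[where F = "\<lambda>z. F z - c"]) (simp_all add: c D.prob_space)
  then have "has_bochner_integral P (\<lambda>w. 1 / (real n)\<^sup>2 * (\<Sum>i<n. F (Z i w) - c)\<^sup>2)
     (1 / (real n)\<^sup>2 * (real n * (\<integral>z. (F z - c)\<^sup>2 \<partial>D)))"
    by (rule has_bochner_integral_mult_right)
  moreover have "1 / (real n)\<^sup>2 * (\<Sum>i<n. F (Z i w) - c)\<^sup>2 = (avg n (\<lambda>i. F (Z i w)) - c)\<^sup>2" for w
    using n by (simp add: avg_def sum_subtractf power_divide[symmetric] diff_divide_distrib)
  moreover have "1 / (real n)\<^sup>2 * (real n * (\<integral>z. (F z - c)\<^sup>2 \<partial>D)) = (\<integral>z. (F z - c)\<^sup>2 \<partial>D) / real n"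
    using n by (simp add: power2_eq_square)
  ultimately have "has_bochner_integral P (\<lambda>w. (avg n (\<lambda>i. F (Z i w)) - c)\<^sup>2)
     (((\<integral>z. (F z)\<^sup>2 \<partial>D) - c\<^sup>2) / real n)" by (simp add: val)
  then show "integrable P (\<lambda>w. (avg n (\<lambda>i. F (Z i w)) - c)\<^sup>2)"
    and "expectation (\<lambda>w. (avg n (\<lambda>i. F (Z i w)) - c)\<^sup>2) \<le> (\<integral>z. (F z)\<^sup>2 \<partial>D) / real n"
    by (auto simp: has_bochner_integral_iff divide_right_mono)
qed

lemma avg_centred_square_bounded:
  fixes F :: "'a \<Rightarrow> real"
  assumes F: "F \<in> borel_measurable D" and bd: "\<And>z. z \<in> space D \<Longrightarrow> \<bar>F z\<bar> \<le> K"
    and c: "(\<integral>z. F z \<partial>D) = c" and n: "0 < n"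
  shows "integrable P (\<lambda>w. (avg n (\<lambda>i. F (Z i w)) - c)\<^sup>2)"
    and "expectation (\<lambda>w. (avg n (\<lambda>i. F (Z i w)) - c)\<^sup>2) \<le> K\<^sup>2 / real n"
proof -
  interpret D: prob_space D by (rule law_prob_space)
  have le: "(F z)\<^sup>2 \<le> K\<^sup>2" if "z \<in> space D" for z
    using bd[OF that] by (simp add: abs_le_square_iff[symmetric])
  have F2: "integrable D (\<lambda>z. (F z)\<^sup>2)"
    by (rule D.integrable_const_bound[of _ "K\<^sup>2"]) (use F le in auto)
  have "(\<integral>z. (F z)\<^sup>2 \<partial>D) \<le> K\<^sup>2"
    using D.integral_le_const[OF F2, of "K\<^sup>2"] le by auto
  then have "(\<integral>z. (F z)\<^sup>2 \<partial>D) / real n \<le> K\<^sup>2 / real n" by (rule divide_right_mono) simp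
  then show "expectation (\<lambda>w. (avg n (\<lambda>i. F (Z i w)) - c)\<^sup>2) \<le> K\<^sup>2 / real n"
    using avg_centred_square(2)[OF F F2 c n] by linarith
  show "integrable P (\<lambda>w. (avg n (\<lambda>i. F (Z i w)) - c)\<^sup>2)"
    by (rule avg_centred_square(1)[OF F F2 c n])
qed

end

text \<open>The problem without its operators. \<open>Z i\<close> holds the design point and the
  error, not the response, so the product law \<open>\<mu> \<Otimes>\<^sub>M N\<close> expresses the
  independence of both; the response is \<open>g (fst (Z i \<omega>)) + snd (Z i \<omega>)\<close>.
  The \<open>w k\<close> are only orthonormal, not complete: decay of the truncation remainder is
  supplied separately.\<close>

locale regression_sample = iid_sample P Z "\<mu> \<Otimes>\<^sub>M N"
  for P :: "'w measure" and Z :: "nat \<Rightarrow> 'w \<Rightarrow> 'x \<times> real" and \<mu> :: "'x measure" and N :: "real measure" +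
  fixes g :: "'x \<Rightarrow> real" and w :: "nat \<Rightarrow> 'x \<Rightarrow> real" and a :: "nat \<Rightarrow> real"
    and L :: "real \<Rightarrow> real" and I B C1 C2 :: real
  assumes mu: "prob_space \<mu>" and N: "prob_space N" and sets_N [measurable_cong]: "sets N = sets borel"
    and error_mean: "(\<integral>e. e \<partial>N) = 0" and error_square: "integrable N (\<lambda>e. e\<^sup>2)"
    and g [measurable]: "g \<in> borel_measurable \<mu>" and g_square: "integrable \<mu> (\<lambda>x. (g x)\<^sup>2)"
    and w [measurable]: "\<And>k. w k \<in> borel_measurable \<mu>"
    and w_bound: "\<And>k x. x \<in> space \<mu> \<Longrightarrow> \<bar>w k x\<bar> \<le> B"
    and w_orthonormal: "\<And>k l. (\<integral>x. w k x * w l x \<partial>\<mu>) = (if k = l then 1 else 0)"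
    and a: "\<And>k. a k = (\<integral>x. g x * w k x \<partial>\<mu>)"
    and L_diff: "\<And>y. L differentiable at y" "\<And>y. deriv L differentiable at y"
    and L_deriv_bound: "\<And>y. \<bar>deriv L y\<bar> \<le> C1" "\<And>y. \<bar>deriv (deriv L) y\<bar> \<le> C2"
    and L_mean: "(\<integral>e. L e \<partial>N) = 0"
    and L_square: "integrable N (\<lambda>e. (L e)\<^sup>2)" "(\<integral>e. (L e)\<^sup>2 \<partial>N) = I"
    and L_deriv_mean: "(\<integral>e. deriv L e \<partial>N) = I"
    and I_pos: "0 < I"
begin

sublocale mu: prob_space \<mu> by (rule mu)
sublocale N: prob_space N by (rule N)
sublocale joint: pair_prob_space \<mu> N ..

lemma L_measurable [measurable]: "L \<in> borel_measurable borel" "deriv L \<in> borel_measurable borel"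
  using L_diff by (auto intro!: borel_measurable_continuous_onI simp: continuous_on_eq_continuous_at
      differentiable_imp_continuous_within)

lemma B_nonneg: "0 \<le> B"
proof -
  obtain x where "x \<in> space \<mu>" using mu.not_empty by auto
  from w_bound[OF this, of 0] show ?thesis by linarith
qed

lemma C1_nonneg: "0 \<le> C1" and C2_nonneg: "0 \<le> C2"
  using L_deriv_bound[of 0] by linarith+

lemma w_square_le: "x \<in> space \<mu> \<Longrightarrow> (w k x)\<^sup>2 \<le> B\<^sup>2"
  using w_bound[of x k] by (simp add: abs_le_square_iff[symmetric])

lemma integrable_w: "integrable \<mu> (w k)" "integrable \<mu> (\<lambda>x. w k x * w l x)"
proof -
  show "integrable \<mu> (w k)"
    by (rule mu.integrable_const_bound[of _ B]) (use w_bound in auto)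
  show "integrable \<mu> (\<lambda>x. w k x * w l x)"
    by (rule mu.integrable_const_bound[of _ "B * B"])
      (use w_bound B_nonneg in \<open>auto simp: abs_mult intro!: mult_mono\<close>)
qed

lemma integrable_mult_w:
  assumes "integrable \<mu> u"
  shows "integrable \<mu> (\<lambda>x. u x * w k x)"
proof (rule Bochner_Integration.integrable_bound)
  show "integrable \<mu> (\<lambda>x. B * u x)" using assms by simp
  show "AE x in \<mu>. norm (u x * w k x) \<le> norm (B * u x)"
    by (intro AE_I2) (use w_bound B_nonneg in \<open>auto simp: abs_mult mult.commute[of B] intro!: mult_left_mono\<close>)
qed (use assms in simp)

lemma integrable_g: "integrable \<mu> g"
  using mu.square_integrable_imp_integrable[OF g g_square] .

lemma integrable_error: "integrable N (\<lambda>e. e)"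
  using N.square_integrable_imp_integrable[OF _ error_square] by simp

lemma integrable_L: "integrable N L"
  using N.square_integrable_imp_integrable[OF _ L_square(1)] by simp

lemma integrable_deriv_L: "integrable N (deriv L)"
  by (rule N.integrable_const_bound[of _ C1]) (use L_deriv_bound in auto)

text \<open>Since \<open>a k\<close> stands for \<open>\<rho> k f\<^sub>k\<close>, this is \<open>\<rho> k\<close> times the coefficient estimator.\<close>

definition ahat :: "nat \<Rightarrow> nat \<Rightarrow> 'w \<Rightarrow> real" where
  "ahat n k \<omega> = avg n (\<lambda>i. (g (fst (Z i \<omega>)) + snd (Z i \<omega>)) * w k (fst (Z i \<omega>)))"

definition resid :: "nat \<Rightarrow> 'x \<Rightarrow> real" where
  "resid m x = g x - (\<Sum>k\<le>m. a k * w k x)"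

text \<open>The second moment of a response, as the error is centred and independent of the design
  point.\<close>

definition kappa :: real where
  "kappa = (\<integral>x. (g x)\<^sup>2 \<partial>\<mu>) + (\<integral>e. e\<^sup>2 \<partial>N)"

lemma resid_measurable [measurable]: "resid m \<in> borel_measurable \<mu>"
  unfolding resid_def[abs_def] by measurable

text \<open>The empirical coefficient is unbiased because the errors are centred. The bound
  \<open>B\<close> makes the rate uniform in k; the factor 2 comes from (g + e)^2 \<le> 2 (g^2 +
  e^2), used pointwise in place of the vanishing cross term.\<close>

lemma coefficient_error:
  assumes n: "0 < n"
  shows "integrable P (\<lambda>\<omega>. (a k - ahat n k \<omega>)\<^sup>2)"
    and "expectation (\<lambda>\<omega>. (a k - ahat n k \<omega>)\<^sup>2) \<le> 2 * B\<^sup>2 * kappa / real n"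
proof -
  let ?F = "\<lambda>(x, e). (g x + e) * w k x"
  \<comment> \<open>The factors 1 give each summand the shape of a function of \<open>x\<close>
    times a function of \<open>e\<close>, as the product rule for integrals expects.\<close>
  let ?U = "\<lambda>(x, e). 2 * B\<^sup>2 * ((g x)\<^sup>2 * 1 + 1 * e\<^sup>2)"
  have U: "has_bochner_integral (\<mu> \<Otimes>\<^sub>M N) ?U (2 * B\<^sup>2 * kappa)"
  proof -
    have "has_bochner_integral (\<mu> \<Otimes>\<^sub>M N) (\<lambda>z. 2 * B\<^sup>2 * ((case z of (x, e) \<Rightarrow> (g x)\<^sup>2 * 1) + (case z of (x, e) \<Rightarrow> 1 * e\<^sup>2)))
       (2 * B\<^sup>2 * ((\<integral>x. (g x)\<^sup>2 \<partial>\<mu>) * (\<integral>e. 1 \<partial>N) + (\<integral>x. 1 \<partial>\<mu>) * (\<integral>e. e\<^sup>2 \<partial>N)))"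
      by (intro has_bochner_integral_mult_right has_bochner_integral_add joint.has_bochner_integral_product)
        (use g_square error_square in auto)
    then show ?thesis by (simp add: kappa_def split_def mu.prob_space N.prob_space)
  qed
  have le: "(?F z)\<^sup>2 \<le> ?U z" if "z \<in> space (\<mu> \<Otimes>\<^sub>M N)" for z
  proof (cases z)
    case (Pair x e)
    then have x: "x \<in> space \<mu>" using that by (simp add: space_pair_measure)
    have "0 \<le> (g x - e)\<^sup>2" by simp
    then have "(g x + e)\<^sup>2 \<le> 2 * ((g x)\<^sup>2 + e\<^sup>2)"
      by (simp add: power2_sum power2_diff)
    then have "(g x + e)\<^sup>2 * (w k x)\<^sup>2 \<le> (2 * ((g x)\<^sup>2 + e\<^sup>2)) * B\<^sup>2"
      by (intro mult_mono w_square_le x) auto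
    then show ?thesis unfolding Pair prod.case power_mult_distrib by (simp only: mult_1_right mult_1 ac_simps)
  qed
  have F2: "integrable (\<mu> \<Otimes>\<^sub>M N) (\<lambda>z. (?F z)\<^sup>2)"
  proof (rule Bochner_Integration.integrable_bound)
    show "integrable (\<mu> \<Otimes>\<^sub>M N) ?U" using U by (simp add: has_bochner_integral_iff)
    have "0 \<le> (?F z)\<^sup>2" for z by simp
    with le show "AE z in \<mu> \<Otimes>\<^sub>M N. norm ((?F z)\<^sup>2) \<le> norm (?U z)"
      by (intro AE_I2) (smt (verit, best) real_norm_def)
  qed measurable
  have le2: "(\<integral>z. (?F z)\<^sup>2 \<partial>(\<mu> \<Otimes>\<^sub>M N)) \<le> 2 * B\<^sup>2 * kappa"
    using integral_mono[OF F2 _ le] U by (simp add: has_bochner_integral_iff)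
  have mean: "(\<integral>z. ?F z \<partial>(\<mu> \<Otimes>\<^sub>M N)) = a k"
  proof -
    have "has_bochner_integral (\<mu> \<Otimes>\<^sub>M N) (\<lambda>z. (case z of (x, e) \<Rightarrow> (g x * w k x) * 1) + (case z of (x, e) \<Rightarrow> w k x * e))
       ((\<integral>x. g x * w k x \<partial>\<mu>) * (\<integral>e. 1 \<partial>N) + (\<integral>x. w k x \<partial>\<mu>) * (\<integral>e. e \<partial>N))"
      by (intro has_bochner_integral_add joint.has_bochner_integral_product integrable_mult_w
          integrable_g integrable_w integrable_error) simp
    moreover have "(\<lambda>z. (case z of (x, e) \<Rightarrow> (g x * w k x) * 1) + (case z of (x, e) \<Rightarrow> w k x * e)) = ?F"
      by (auto simp: fun_eq_iff algebra_simps)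
    ultimately show ?thesis
      by (simp add: has_bochner_integral_iff error_mean N.prob_space a)
  qed
  have eq: "(a k - ahat n k \<omega>)\<^sup>2 = (avg n (\<lambda>i. ?F (Z i \<omega>)) - a k)\<^sup>2" for \<omega>
    by (simp add: ahat_def power2_commute split_def)
  have meas: "?F \<in> borel_measurable (\<mu> \<Otimes>\<^sub>M N)" by measurable
  note * = avg_centred_square[OF meas F2 mean n]
  show "integrable P (\<lambda>\<omega>. (a k - ahat n k \<omega>)\<^sup>2)" unfolding eq by (rule *(1))
  have "(\<integral>z. (?F z)\<^sup>2 \<partial>(\<mu> \<Otimes>\<^sub>M N)) / real n \<le> 2 * B\<^sup>2 * kappa / real n"
    by (rule divide_right_mono[OF le2]) simp
  with *(2) show "expectation (\<lambda>\<omega>. (a k - ahat n k \<omega>)\<^sup>2) \<le> 2 * B\<^sup>2 * kappa / real n"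
    unfolding eq by linarith
qed

text \<open>By independence the mean factors into E L' = \<open>I\<close> and the inner product of
  \<open>w k\<close> with \<open>w 0\<close>, so it is \<open>I\<close> for k = 0 and zero
  otherwise.\<close>

lemma score_average_error:
  assumes n: "0 < n"
  defines "H \<equiv> \<lambda>k \<omega>. avg n (\<lambda>i. deriv L (snd (Z i \<omega>)) * (w k (fst (Z i \<omega>)) * w 0 (fst (Z i \<omega>))))
      - (if k = 0 then I else 0)"
  shows "integrable P (\<lambda>\<omega>. (H k \<omega>)\<^sup>2)"
    and "expectation (\<lambda>\<omega>. (H k \<omega>)\<^sup>2) \<le> (C1 * (B * B))\<^sup>2 / real n"
proof -
  let ?F = "\<lambda>(x, e). (w k x * w 0 x) * deriv L e"
  have mean: "(\<integral>z. ?F z \<partial>(\<mu> \<Otimes>\<^sub>M N)) = (if k = 0 then I else 0)"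
    using joint.has_bochner_integral_product[OF integrable_w(2)[of k 0] integrable_deriv_L]
    by (simp add: has_bochner_integral_iff w_orthonormal L_deriv_mean)
  have bd: "\<bar>?F z\<bar> \<le> C1 * (B * B)" if "z \<in> space (\<mu> \<Otimes>\<^sub>M N)" for z
  proof (cases z)
    case (Pair x e)
    then have x: "x \<in> space \<mu>" using that by (simp add: space_pair_measure)
    have "\<bar>deriv L e\<bar> * (\<bar>w k x\<bar> * \<bar>w 0 x\<bar>) \<le> C1 * (B * B)"
      by (intro mult_mono w_bound x L_deriv_bound) (auto simp: B_nonneg C1_nonneg)
    then show ?thesis by (simp add: Pair abs_mult mult_ac)
  qed
  have meas: "?F \<in> borel_measurable (\<mu> \<Otimes>\<^sub>M N)" by measurable
  have eq: "H k \<omega> = avg n (\<lambda>i. ?F (Z i \<omega>)) - (if k = 0 then I else 0)" for \<omega>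
    by (simp add: H_def split_def mult_ac)
  show "integrable P (\<lambda>\<omega>. (H k \<omega>)\<^sup>2)"
    and "expectation (\<lambda>\<omega>. (H k \<omega>)\<^sup>2) \<le> (C1 * (B * B))\<^sup>2 / real n"
    unfolding eq by (rule avg_centred_square_bounded[OF meas bd mean n], assumption)+
qed

text \<open>Orthonormality gives the mean of each entry. Summed over (m + 1)^2 entries, these bounds
  control the squared Frobenius error.\<close>

lemma Gram_error:
  assumes n: "0 < n"
  defines "G \<equiv> \<lambda>k l \<omega>. avg n (\<lambda>i. w k (fst (Z i \<omega>)) * w l (fst (Z i \<omega>))) - (if k = l then 1 else 0)"
  shows "integrable P (\<lambda>\<omega>. (G k l \<omega>)\<^sup>2)"
    and "expectation (\<lambda>\<omega>. (G k l \<omega>)\<^sup>2) \<le> (B * B)\<^sup>2 / real n"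
proof -
  let ?F = "\<lambda>(x, e). (w k x * w l x) * 1"
  have "integrable N (\<lambda>e. 1 :: real)" by simp
  then have mean: "(\<integral>z. ?F z \<partial>(\<mu> \<Otimes>\<^sub>M N)) = (if k = l then 1 else 0)"
    using joint.has_bochner_integral_product[OF integrable_w(2)[of k l], of "\<lambda>e. 1"]
    by (simp add: has_bochner_integral_iff w_orthonormal N.prob_space)
  have bd: "\<bar>?F z\<bar> \<le> B * B" if "z \<in> space (\<mu> \<Otimes>\<^sub>M N)" for z
    using that by (auto simp: space_pair_measure abs_mult B_nonneg intro!: mult_mono w_bound)
  have meas: "?F \<in> borel_measurable (\<mu> \<Otimes>\<^sub>M N)" by measurable
  have eq: "G k l \<omega> = avg n (\<lambda>i. ?F (Z i \<omega>)) - (if k = l then 1 else 0)" for \<omega>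
    by (simp add: G_def split_def)
  show "integrable P (\<lambda>\<omega>. (G k l \<omega>)\<^sup>2)"
    and "expectation (\<lambda>\<omega>. (G k l \<omega>)\<^sup>2) \<le> (B * B)\<^sup>2 / real n"
    unfolding eq by (rule avg_centred_square_bounded[OF meas bd mean n], assumption)+
qed

end

section \<open>Truncation remainder and limit law of the one-step estimator\<close>

context regression_sample begin

definition delta :: "nat \<Rightarrow> real" where
  "delta m = (\<integral>x. (resid m x)\<^sup>2 \<partial>\<mu>)"

lemma integrable_resid_square: "integrable \<mu> (\<lambda>x. (resid m x)\<^sup>2)"
proof -
  have w2: "w k \<in> L2 \<mu>" for k
    using integrable_w(2)[of k k] by (simp add: L2_def power2_eq_square)
  have "(\<lambda>x. g x + (\<Sum>k\<le>m. (- a k) * w k x)) \<in> L2 \<mu>"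
    by (intro L2_add L2_lincomb w2) (simp add: L2_def g_square)
  moreover have "(\<lambda>x. g x + (\<Sum>k\<le>m. (- a k) * w k x)) = resid m"
    by (simp add: fun_eq_iff resid_def sum_negf)
  ultimately have "resid m \<in> L2 \<mu>" by metis
  then show ?thesis by (simp add: L2_def)
qed

lemma resid_orthogonal: "j \<le> m \<Longrightarrow> (\<integral>x. resid m x * w j x \<partial>\<mu>) = 0"
proof -
  assume j: "j \<le> m"
  have "(\<integral>x. resid m x * w j x \<partial>\<mu>) = (\<integral>x. g x * w j x - (\<Sum>k\<le>m. a k * (w k x * w j x)) \<partial>\<mu>)"
    by (simp add: resid_def left_diff_distrib sum_distrib_right mult.assoc)
  also have "\<dots> = a j - (\<Sum>k\<le>m. a k * (\<integral>x. w k x * w j x \<partial>\<mu>))"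
    using integrable_mult_w[OF integrable_g] integrable_w(2)
    by (simp add: Bochner_Integration.integral_diff Bochner_Integration.integral_sum a)
  also have "\<dots> = 0" using j by (simp add: w_orthonormal if_distrib cong: if_cong)
  finally show ?thesis .
qed

text \<open>Centred, because the remainder is orthogonal to \<open>w 0\<close> and independent of
  the errors. The remainder has no uniform bound, so its squared norm \<open>delta m\<close> takes
  the place of one; after scaling by \<surd>n only \<open>sqrt (delta m)\<close> is left.\<close>

lemma truncation_average:
  fixes m :: nat
  assumes n: "0 < n"
  defines "Q \<equiv> \<lambda>\<omega>. avg n (\<lambda>i. deriv L (snd (Z i \<omega>)) * (resid m (fst (Z i \<omega>)) * w 0 (fst (Z i \<omega>))))"
  shows "integrable P (\<lambda>\<omega>. (Q \<omega>)\<^sup>2)"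
    and "expectation (\<lambda>\<omega>. (Q \<omega>)\<^sup>2) \<le> (C1 * B)\<^sup>2 * delta m / real n"
proof -
  let ?F = "\<lambda>(x, e). (resid m x * w 0 x) * deriv L e"
  let ?U = "\<lambda>(x, e). ((C1 * B)\<^sup>2 * (resid m x)\<^sup>2) * 1"
  have r: "integrable \<mu> (resid m)"
    by (rule mu.square_integrable_imp_integrable[OF _ integrable_resid_square]) simp
  have mean: "(\<integral>z. ?F z \<partial>(\<mu> \<Otimes>\<^sub>M N)) = 0"
    using joint.has_bochner_integral_product[OF integrable_mult_w[OF r, of 0] integrable_deriv_L]
    by (simp add: has_bochner_integral_iff resid_orthogonal)
  have U: "has_bochner_integral (\<mu> \<Otimes>\<^sub>M N) ?U ((C1 * B)\<^sup>2 * delta m)"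
    using joint.has_bochner_integral_product[of "\<lambda>x. (C1 * B)\<^sup>2 * (resid m x)\<^sup>2" "\<lambda>e. 1"]
    by (simp add: integrable_resid_square N.prob_space delta_def)
  have le: "(?F z)\<^sup>2 \<le> ?U z" if "z \<in> space (\<mu> \<Otimes>\<^sub>M N)" for z
  proof (cases z)
    case (Pair x e)
    then have x: "x \<in> space \<mu>" using that by (simp add: space_pair_measure)
    have "\<bar>deriv L e\<bar> * \<bar>w 0 x\<bar> \<le> C1 * B"
      by (intro mult_mono w_bound x L_deriv_bound) (auto simp: B_nonneg C1_nonneg)
    then have "(deriv L e * w 0 x)\<^sup>2 \<le> (C1 * B)\<^sup>2"
      by (metis abs_ge_zero abs_mult power2_abs power_mono)
    then have "(deriv L e * w 0 x)\<^sup>2 * (resid m x)\<^sup>2 \<le> (C1 * B)\<^sup>2 * (resid m x)\<^sup>2"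
      by (rule mult_right_mono) simp
    then show ?thesis by (simp add: Pair power_mult_distrib mult_ac)
  qed
  have F2: "integrable (\<mu> \<Otimes>\<^sub>M N) (\<lambda>z. (?F z)\<^sup>2)"
  proof (rule Bochner_Integration.integrable_bound)
    show "integrable (\<mu> \<Otimes>\<^sub>M N) ?U" using U by (simp add: has_bochner_integral_iff)
    have "0 \<le> (?F z)\<^sup>2" for z by simp
    with le show "AE z in \<mu> \<Otimes>\<^sub>M N. norm ((?F z)\<^sup>2) \<le> norm (?U z)"
      by (intro AE_I2) (smt (verit, best) real_norm_def)
  qed measurable
  have le2: "(\<integral>z. (?F z)\<^sup>2 \<partial>(\<mu> \<Otimes>\<^sub>M N)) \<le> (C1 * B)\<^sup>2 * delta m"
    using integral_mono[OF F2 _ le] U by (simp add: has_bochner_integral_iff)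
  have meas: "?F \<in> borel_measurable (\<mu> \<Otimes>\<^sub>M N)" by measurable
  have eq: "Q \<omega> = avg n (\<lambda>i. ?F (Z i \<omega>)) - 0" for \<omega>
    by (simp add: Q_def split_def mult_ac)
  note * = avg_centred_square[OF meas F2 mean n]
  show "integrable P (\<lambda>\<omega>. (Q \<omega>)\<^sup>2)" unfolding eq by (rule *(1))
  have "(\<integral>z. (?F z)\<^sup>2 \<partial>(\<mu> \<Otimes>\<^sub>M N)) / real n \<le> (C1 * B)\<^sup>2 * delta m / real n"
    by (rule divide_right_mono[OF le2]) simp
  with *(2) show "expectation (\<lambda>\<omega>. (Q \<omega>)\<^sup>2) \<le> (C1 * B)\<^sup>2 * delta m / real n"
    unfolding eq by linarith
qed

lemma resid_average:
  assumes n: "0 < n"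
  shows "has_bochner_integral P (\<lambda>\<omega>. avg n (\<lambda>i. (resid m (fst (Z i \<omega>)))\<^sup>2)) (delta m)"
proof -
  let ?F = "\<lambda>(x, e). (resid m x)\<^sup>2 * 1"
  have F: "has_bochner_integral (\<mu> \<Otimes>\<^sub>M N) ?F (delta m)"
    using joint.has_bochner_integral_product[of "\<lambda>x. (resid m x)\<^sup>2" "\<lambda>e. 1"]
    by (simp add: integrable_resid_square N.prob_space delta_def)
  have meas: "?F \<in> borel_measurable (\<mu> \<Otimes>\<^sub>M N)" by measurable
  have "has_bochner_integral P (\<lambda>\<omega>. ?F (Z i \<omega>)) (delta m)" for i
    using F integrable_sample[of ?F] expectation_sample[OF meas] by (simp add: has_bochner_integral_iff)
  then have "has_bochner_integral P (\<lambda>\<omega>. (\<Sum>i<n. ?F (Z i \<omega>)) / real n) ((\<Sum>i<n. delta m) / real n)"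
    by (intro has_bochner_integral_divide has_bochner_integral_sum)
  then show ?thesis using n by (simp add: avg_def split_def)
qed

text \<open>Its target is \<open>a 0\<close>, that is \<open>\<rho> 0\<close> times the coefficient
  of interest; the division by \<open>\<rho> 0\<close> takes place in the final limit
  theorem.\<close>

definition one_step :: "nat \<Rightarrow> nat \<Rightarrow> 'w \<Rightarrow> real" where
  "one_step n m \<omega> = ahat n 0 \<omega> + avg n (\<lambda>i. 1 / I *
     L (g (fst (Z i \<omega>)) + snd (Z i \<omega>) - (\<Sum>k\<le>m. ahat n k \<omega> * w k (fst (Z i \<omega>)))) * w 0 (fst (Z i \<omega>)))"

definition efficient_average :: "nat \<Rightarrow> 'w \<Rightarrow> real" where
  "efficient_average n \<omega> = 1 / I * avg n (\<lambda>i. L (snd (Z i \<omega>)) * w 0 (fst (Z i \<omega>)))"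

lemma avg_measurable [measurable]:
  assumes [measurable]: "\<And>i. f i \<in> borel_measurable P"
  shows "(\<lambda>\<omega>. avg n (\<lambda>i. f i \<omega>)) \<in> borel_measurable P"
  unfolding avg_def by measurable

lemma sample_measurable [measurable]:
  "(\<lambda>\<omega>. fst (Z i \<omega>)) \<in> measurable P \<mu>" "(\<lambda>\<omega>. snd (Z i \<omega>)) \<in> borel_measurable P"
proof -
  show "(\<lambda>\<omega>. fst (Z i \<omega>)) \<in> measurable P \<mu>"
    by (rule measurable_compose[OF Z_measurable measurable_fst])
  have "(\<lambda>\<omega>. snd (Z i \<omega>)) \<in> measurable P N"
    by (rule measurable_compose[OF Z_measurable measurable_snd])
  then show "(\<lambda>\<omega>. snd (Z i \<omega>)) \<in> borel_measurable P"
    by (simp add: measurable_cong_sets[OF refl sets_N])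
qed

lemma ahat_measurable [measurable]: "ahat n k \<in> borel_measurable P"
  unfolding ahat_def[abs_def] by measurable

lemma one_step_measurable [measurable]: "one_step n m \<in> borel_measurable P"
  unfolding one_step_def[abs_def] by measurable

lemma efficient_average_measurable [measurable]: "efficient_average n \<in> borel_measurable P"
  unfolding efficient_average_def[abs_def] by measurable

text \<open>
  With \<open>s\<close> the scaled squared error of the coefficients and \<open>F\<close> the squared Frobenius error of the
  Gram matrix, \<open>s (1 + sqrt F)\<close> need not have a small mean, but \<open>min 1 (s (1 + sqrt F)) \<le> 2 s + F\<close>.
\<close>

lemma one_step_error:
  fixes m :: nat
  assumes n: "0 < n"
  defines "M \<equiv> real (m + 1) / sqrt (real n)"
  shows "expectation (\<lambda>\<omega>. min 1 \<bar>sqrt (real n) * (one_step n m \<omega> - a 0 - efficient_average n \<omega>)\<bar>)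
    \<le> 1 / I * (M * (2 * B\<^sup>2 * kappa + (C1 * (B * B))\<^sup>2) + C1 * B * sqrt (delta m))
      + 2 * C2 * B / I * (sqrt (real n) * delta m + 2 * (M * (2 * B\<^sup>2 * kappa)))
      + M\<^sup>2 * (B * B)\<^sup>2"
proof -
  define b where "b = (\<lambda>k \<omega>. a k - ahat n k \<omega>)"
  define H where "H = (\<lambda>k \<omega>. avg n (\<lambda>i. deriv L (snd (Z i \<omega>)) * (w k (fst (Z i \<omega>)) * w 0 (fst (Z i \<omega>))))
      - (if k = 0 then I else 0))"
  define G where "G = (\<lambda>k l \<omega>. avg n (\<lambda>i. w k (fst (Z i \<omega>)) * w l (fst (Z i \<omega>))) - (if k = l then 1 else 0))"
  define Q where "Q = (\<lambda>\<omega>. avg n (\<lambda>i. deriv L (snd (Z i \<omega>)) * (resid m (fst (Z i \<omega>)) * w 0 (fst (Z i \<omega>)))))"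
  define r where "r = (\<lambda>\<omega>. avg n (\<lambda>i. (resid m (fst (Z i \<omega>)))\<^sup>2))"
  define s where "s = (\<lambda>\<omega>. \<Sum>k\<le>m. (b k \<omega>)\<^sup>2)"
  define h where "h = (\<lambda>\<omega>. \<Sum>k\<le>m. (H k \<omega>)\<^sup>2)"
  define F where "F = (\<lambda>\<omega>. \<Sum>k\<le>m. \<Sum>l\<le>m. (G k l \<omega>)\<^sup>2)"
  define c where "c = 2 * C2 * B / I"
  let ?n = "sqrt (real n)"
  have n0: "0 < ?n" using n by simp
  have c0: "0 \<le> c" using I_pos B_nonneg C2_nonneg by (simp add: c_def)
  have b: "integrable P (\<lambda>\<omega>. (b k \<omega>)\<^sup>2)" "expectation (\<lambda>\<omega>. (b k \<omega>)\<^sup>2) \<le> 2 * B\<^sup>2 * kappa / real n" for k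
    unfolding b_def by (rule coefficient_error[OF n])+
  have H: "integrable P (\<lambda>\<omega>. (H k \<omega>)\<^sup>2)" "expectation (\<lambda>\<omega>. (H k \<omega>)\<^sup>2) \<le> (C1 * (B * B))\<^sup>2 / real n" for k
    unfolding H_def by (rule score_average_error[OF n])+
  have G: "integrable P (\<lambda>\<omega>. (G k l \<omega>)\<^sup>2)" "expectation (\<lambda>\<omega>. (G k l \<omega>)\<^sup>2) \<le> (B * B)\<^sup>2 / real n" for k l
    unfolding G_def by (rule Gram_error[OF n])+
  have Q: "integrable P (\<lambda>\<omega>. (Q \<omega>)\<^sup>2)" "expectation (\<lambda>\<omega>. (Q \<omega>)\<^sup>2) \<le> (C1 * B)\<^sup>2 * delta m / real n"
    unfolding Q_def by (rule truncation_average[OF n])+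
  have r: "integrable P r" "expectation r = delta m"
    using resid_average[OF n] by (simp_all add: has_bochner_integral_iff r_def)
  have s: "integrable P s" and h: "integrable P h" and F: "integrable P F"
    using b H G by (simp_all add: s_def h_def F_def)
  \<comment> \<open>The index range k \<le> m has m + 1 elements, each contributing a mean of order
    1/n; this is why \<open>M\<close> contains \<open>m + 1\<close>.\<close>
  have scale: "?n * (real (m + 1) * (C / real n)) = M * C" for C
  proof -
    have "?n / real n = 1 / ?n" using n by (simp add: field_simps)
    moreover have "?n * (real (m + 1) * (C / real n)) = real (m + 1) * C * (?n / real n)" by simp
    ultimately show ?thesis by (simp add: M_def)
  qed
  have Es: "?n * expectation s \<le> M * (2 * B\<^sup>2 * kappa)"
  proof -
    have "expectation s = (\<Sum>k\<le>m. expectation (\<lambda>\<omega>. (b k \<omega>)\<^sup>2))"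
      using b by (simp add: s_def Bochner_Integration.integral_sum)
    also have "\<dots> \<le> (\<Sum>k\<le>m. 2 * B\<^sup>2 * kappa / real n)" by (rule sum_mono) (rule b)
    finally have "?n * expectation s \<le> ?n * (real (m + 1) * (2 * B\<^sup>2 * kappa / real n))"
      by (intro mult_left_mono) auto
    then show ?thesis unfolding scale .
  qed
  have Eh: "?n * expectation h \<le> M * (C1 * (B * B))\<^sup>2"
  proof -
    have "expectation h = (\<Sum>k\<le>m. expectation (\<lambda>\<omega>. (H k \<omega>)\<^sup>2))"
      using H by (simp add: h_def Bochner_Integration.integral_sum)
    also have "\<dots> \<le> (\<Sum>k\<le>m. (C1 * (B * B))\<^sup>2 / real n)" by (rule sum_mono) (rule H)
    finally have "?n * expectation h \<le> ?n * (real (m + 1) * ((C1 * (B * B))\<^sup>2 / real n))"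
      by (intro mult_left_mono) auto
    then show ?thesis unfolding scale .
  qed
  have EF: "expectation F \<le> M\<^sup>2 * (B * B)\<^sup>2"
  proof -
    have "expectation F = (\<Sum>k\<le>m. \<Sum>l\<le>m. expectation (\<lambda>\<omega>. (G k l \<omega>)\<^sup>2))"
      using G by (simp add: F_def Bochner_Integration.integral_sum)
    also have "\<dots> \<le> (\<Sum>k\<le>m. \<Sum>l\<le>m. (B * B)\<^sup>2 / real n)" by (intro sum_mono) (rule G)
    also have "\<dots> = M\<^sup>2 * (B * B)\<^sup>2"
      by (simp add: M_def power_divide power2_eq_square[of "1 + real m"] add.commute)
    finally show ?thesis .
  qed
  \<comment> \<open>\<open>Q\<close> enters linearly, so its first absolute moment is needed and is
    taken from the second one; its decay 1/\<surd>n absorbs the scaling exactly.\<close>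
  have EQ: "?n * expectation (\<lambda>\<omega>. \<bar>Q \<omega>\<bar>) \<le> C1 * B * sqrt (delta m)"
  proof -
    have "expectation (\<lambda>\<omega>. \<bar>Q \<omega>\<bar>) \<le> sqrt (expectation (\<lambda>\<omega>. (Q \<omega>)\<^sup>2))"
      by (rule expectation_abs_le_sqrt[OF _ Q(1)]) (simp add: Q_def)
    also have "\<dots> \<le> sqrt ((C1 * B)\<^sup>2 * delta m / real n)" by (rule real_sqrt_le_mono[OF Q(2)])
    also have "\<dots> = C1 * B * sqrt (delta m) / ?n"
      using B_nonneg C1_nonneg by (simp add: real_sqrt_mult real_sqrt_divide)
    finally show ?thesis using n0 by (simp add: field_simps)
  qed
  have iQ: "integrable P (\<lambda>\<omega>. \<bar>Q \<omega>\<bar>)"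
    using square_integrable_imp_integrable[OF _ Q(1)] by (simp add: Q_def)
  let ?R = "\<lambda>\<omega>. 1 / I * (?n * s \<omega> + ?n * h \<omega> + ?n * \<bar>Q \<omega>\<bar>) + c * (?n * r \<omega> + 2 * (?n * s \<omega>)) + F \<omega>"
  have main: "min 1 \<bar>?n * (one_step n m \<omega> - a 0 - efficient_average n \<omega>)\<bar> \<le> ?R \<omega>"
    if \<omega>: "\<omega> \<in> space P" for \<omega>
  proof -
    have x: "fst (Z i \<omega>) \<in> space \<mu>" for i
      using measurable_space[OF Z_measurable[of i] \<omega>] by (auto simp: space_pair_measure)
    have s0: "0 \<le> s \<omega>" and F0: "0 \<le> F \<omega>" and h0: "0 \<le> h \<omega>" and r0: "0 \<le> r \<omega>"
      by (auto simp: s_def F_def h_def r_def intro!: sum_nonneg avg_nonneg)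
    have "\<bar>one_step n m \<omega> - a 0 - efficient_average n \<omega>\<bar>
      \<le> 1 / I * (\<bar>\<Sum>k\<le>m. b k \<omega> * H k \<omega>\<bar> + \<bar>Q \<omega>\<bar> + 2 * C2 * B * (r \<omega> + s \<omega> * (1 + sqrt (F \<omega>))))"
      using one_step_expansion[of L "deriv L" C2 n "\<lambda>k i. w k (fst (Z i \<omega>))" B I
          "\<lambda>k. ahat n k \<omega>" "\<lambda>i. g (fst (Z i \<omega>))" "\<lambda>i. snd (Z i \<omega>)" m a,
          OF Taylor_quadratic_bound[OF L_diff L_deriv_bound(2)] w_bound[OF x] I_pos n]
      unfolding one_step_def efficient_average_def b_def H_def Q_def r_def s_def F_def G_def resid_def .
    \<comment> \<open>Both factors depend on the same observations. Passing to squares leaves two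
      sums with separately known means, each of the same order.\<close>
    moreover have "\<bar>\<Sum>k\<le>m. b k \<omega> * H k \<omega>\<bar> \<le> s \<omega> + h \<omega>"
    proof -
      have "\<bar>b k \<omega> * H k \<omega>\<bar> \<le> (b k \<omega>)\<^sup>2 + (H k \<omega>)\<^sup>2" for k
      proof -
        have "2 * (\<bar>b k \<omega>\<bar> * \<bar>H k \<omega>\<bar>) \<le> (b k \<omega>)\<^sup>2 + (H k \<omega>)\<^sup>2"
          using zero_le_power2[of "\<bar>b k \<omega>\<bar> - \<bar>H k \<omega>\<bar>"] by (simp add: power2_diff)
        moreover have "0 \<le> \<bar>b k \<omega>\<bar> * \<bar>H k \<omega>\<bar>" by simp
        ultimately show ?thesis unfolding abs_mult by linarith
      qed
      then have "(\<Sum>k\<le>m. \<bar>b k \<omega> * H k \<omega>\<bar>) \<le> (\<Sum>k\<le>m. (b k \<omega>)\<^sup>2 + (H k \<omega>)\<^sup>2)" by (rule sum_mono)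
      then have "\<bar>\<Sum>k\<le>m. b k \<omega> * H k \<omega>\<bar> \<le> (\<Sum>k\<le>m. (b k \<omega>)\<^sup>2 + (H k \<omega>)\<^sup>2)"
        by (rule order_trans[OF sum_abs])
      then show ?thesis by (simp add: s_def h_def sum.distrib)
    qed
    then have "1 / I * (\<bar>\<Sum>k\<le>m. b k \<omega> * H k \<omega>\<bar> + \<bar>Q \<omega>\<bar> + 2 * C2 * B * (r \<omega> + s \<omega> * (1 + sqrt (F \<omega>))))
      \<le> 1 / I * (s \<omega> + h \<omega> + \<bar>Q \<omega>\<bar> + 2 * C2 * B * (r \<omega> + s \<omega> * (1 + sqrt (F \<omega>))))"
      using I_pos by (intro mult_left_mono add_right_mono) auto
    moreover have "1 / I * (s \<omega> + h \<omega> + \<bar>Q \<omega>\<bar> + 2 * C2 * B * (r \<omega> + s \<omega> * (1 + sqrt (F \<omega>))))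
      = 1 / I * (s \<omega> + h \<omega> + \<bar>Q \<omega>\<bar>) + c * (r \<omega> + s \<omega> * (1 + sqrt (F \<omega>)))"
      by (simp only: c_def distrib_left times_divide_eq_left mult_1)
    ultimately have "\<bar>one_step n m \<omega> - a 0 - efficient_average n \<omega>\<bar>
      \<le> 1 / I * (s \<omega> + h \<omega> + \<bar>Q \<omega>\<bar>) + c * (r \<omega> + s \<omega> * (1 + sqrt (F \<omega>)))"
      by linarith
    then have "?n * \<bar>one_step n m \<omega> - a 0 - efficient_average n \<omega>\<bar>
      \<le> ?n * (1 / I * (s \<omega> + h \<omega> + \<bar>Q \<omega>\<bar>) + c * (r \<omega> + s \<omega> * (1 + sqrt (F \<omega>))))"
      by (rule mult_left_mono) simp
    also have "\<dots> = 1 / I * (?n * s \<omega> + ?n * h \<omega> + ?n * \<bar>Q \<omega>\<bar>) + c * (?n * r \<omega>) + c * (?n * s \<omega>) * (1 + sqrt (F \<omega>))"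
      by (simp add: algebra_simps add_divide_distrib)
    finally have bound: "\<bar>?n * (one_step n m \<omega> - a 0 - efficient_average n \<omega>)\<bar>
      \<le> 1 / I * (?n * s \<omega> + ?n * h \<omega> + ?n * \<bar>Q \<omega>\<bar>) + c * (?n * r \<omega>) + c * (?n * s \<omega>) * (1 + sqrt (F \<omega>))"
      by (simp add: abs_mult)
    show ?thesis
    proof (cases "F \<omega> \<le> 1")
      case True
      then have "c * (?n * s \<omega>) * (1 + sqrt (F \<omega>)) \<le> c * (?n * s \<omega>) * 2"
        using c0 s0 by (intro mult_left_mono) auto
      with bound F0 show ?thesis by (simp add: algebra_simps)
    next
      case False
      then have "1 \<le> F \<omega>" by simp
      moreover have "0 \<le> 1 / I * (?n * s \<omega> + ?n * h \<omega> + ?n * \<bar>Q \<omega>\<bar>) + c * (?n * r \<omega> + 2 * (?n * s \<omega>))"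
        using I_pos c0 s0 h0 r0 by (intro add_nonneg_nonneg mult_nonneg_nonneg) auto
      ultimately show ?thesis by linarith
    qed
  qed
  have "expectation (\<lambda>\<omega>. min 1 \<bar>?n * (one_step n m \<omega> - a 0 - efficient_average n \<omega>)\<bar>) \<le> expectation ?R"
    by (rule integral_mono[OF _ _ main]) (use s h F r iQ in \<open>auto intro!: integrable_const_bound[of _ 1]\<close>)
  also have "expectation ?R = 1 / I * (?n * expectation s + ?n * expectation h + ?n * expectation (\<lambda>\<omega>. \<bar>Q \<omega>\<bar>))
      + c * (?n * delta m + 2 * (?n * expectation s)) + expectation F"
    using s h F r iQ by simp
  also have "\<dots> \<le> 1 / I * (M * (2 * B\<^sup>2 * kappa) + M * (C1 * (B * B))\<^sup>2 + C1 * B * sqrt (delta m))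
      + c * (?n * delta m + 2 * (M * (2 * B\<^sup>2 * kappa))) + M\<^sup>2 * (B * B)\<^sup>2"
    using I_pos c0 by (intro add_mono mult_left_mono Es Eh EQ EF order_refl) auto
  finally show ?thesis unfolding c_def by (simp add: distrib_left)
qed

lemma one_step_error_tendsto_0:
  assumes m: "(\<lambda>n. real (m n) / sqrt (real n)) \<longlonglongrightarrow> 0"
    and d: "(\<lambda>n. sqrt (real n) * delta (m n)) \<longlonglongrightarrow> 0"
  shows "(\<lambda>n. expectation (\<lambda>\<omega>. min 1 \<bar>sqrt (real n) * (one_step n (m n) \<omega> - a 0 - efficient_average n \<omega>)\<bar>))
    \<longlonglongrightarrow> 0"
proof -
  define M where "M = (\<lambda>n. real (m n + 1) / sqrt (real n))"
  have "(\<lambda>n. 1 / sqrt (real n)) \<longlonglongrightarrow> 0" by real_asymp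
  from tendsto_add[OF m this] have M: "M \<longlonglongrightarrow> 0"
    by (simp add: M_def[abs_def] add_divide_distrib add.commute)
  have delta0: "0 \<le> delta k" for k by (simp add: delta_def)
  \<comment> \<open>The term with \<open>sqrt (delta m)\<close> needs the unscaled tail; it is
    dominated by the scaled one, as \<surd>n is at least 1 for positive n.\<close>
  have dm: "(\<lambda>n. delta (m n)) \<longlonglongrightarrow> 0"
  proof (rule real_tendsto_sandwich[OF _ _ tendsto_const d])
    show "\<forall>\<^sub>F n in sequentially. delta (m n) \<le> sqrt (real n) * delta (m n)"
      using eventually_ge_at_top[of 1]
    proof eventually_elim
      case (elim n)
      then have "1 \<le> sqrt (real n)" by simp
      from mult_right_mono[OF this delta0] show ?case by simp
    qed
  qed (simp add: delta0)
  let ?U = "\<lambda>n. 1 / I * (M n * (2 * B\<^sup>2 * kappa + (C1 * (B * B))\<^sup>2) + C1 * B * sqrt (delta (m n)))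
      + 2 * C2 * B / I * (sqrt (real n) * delta (m n) + 2 * (M n * (2 * B\<^sup>2 * kappa)))
      + (M n)\<^sup>2 * (B * B)\<^sup>2"
  have "?U \<longlonglongrightarrow> 1 / I * (0 * (2 * B\<^sup>2 * kappa + (C1 * (B * B))\<^sup>2) + C1 * B * sqrt 0)
      + 2 * C2 * B / I * (0 + 2 * (0 * (2 * B\<^sup>2 * kappa))) + 0\<^sup>2 * (B * B)\<^sup>2"
    by (intro tendsto_intros M dm d)
  then have U: "?U \<longlonglongrightarrow> 0" by simp
  show ?thesis
  proof (rule real_tendsto_sandwich[OF _ _ tendsto_const U])
    show "\<forall>\<^sub>F n in sequentially. expectation (\<lambda>\<omega>. min 1 \<bar>sqrt (real n) * (one_step n (m n) \<omega> - a 0 - efficient_average n \<omega>)\<bar>) \<le> ?U n"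
      using eventually_gt_at_top[of 0]
      by eventually_elim (unfold M_def, rule one_step_error)
  qed (auto intro!: always_eventually integral_nonneg_AE)
qed

text \<open>Equality of \<open>\<theta>\<close> with the model estimator is asked for almost surely
  only, because values of \<open>K\<close> at sample points are determined only up to null sets of
  the design.\<close>

theorem one_step_weak_conv:
  assumes m: "(\<lambda>n. real (m n) / sqrt (real n)) \<longlonglongrightarrow> 0"
    and d: "(\<lambda>n. sqrt (real n) * delta (m n)) \<longlonglongrightarrow> 0"
    and \<rho>: "0 < \<rho>" and \<theta>[measurable]: "\<And>n. \<theta> n \<in> borel_measurable P"
    and \<theta>_eq: "\<And>n. 0 < n \<Longrightarrow> AE \<omega> in P. \<theta> n \<omega> = one_step n (m n) \<omega> / \<rho>"
  shows "weak_conv_m (\<lambda>n. distr P borel (\<lambda>\<omega>. sqrt (real n) * (\<theta> n \<omega> - a 0 / \<rho>))) (Normal 0 (1 / (\<rho>\<^sup>2 * I)))"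
proof (rule weak_conv_m_perturbation)
  let ?F = "\<lambda>(x, e). w 0 x * L e"
  let ?S = "\<lambda>n \<omega>. 1 / (\<rho> * I) * ((\<Sum>i<n. ?F (Z i \<omega>)) / sqrt (real n))"
  have meas: "?F \<in> borel_measurable (\<mu> \<Otimes>\<^sub>M N)" by measurable
  have F: "has_bochner_integral (\<mu> \<Otimes>\<^sub>M N) ?F 0"
    using joint.has_bochner_integral_product[OF integrable_w(1)[of 0] integrable_L] by (simp add: L_mean)
  have "has_bochner_integral (\<mu> \<Otimes>\<^sub>M N) (\<lambda>(x, e). (w 0 x * w 0 x) * (L e)\<^sup>2) I"
    using joint.has_bochner_integral_product[OF integrable_w(2)[of 0 0] L_square(1)]
    by (simp add: L_square(2) w_orthonormal)
  moreover have "(\<lambda>(x, e). (w 0 x * w 0 x) * (L e)\<^sup>2) = (\<lambda>z. (?F z)\<^sup>2)"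
    by (auto simp: fun_eq_iff power_mult_distrib power2_eq_square)
  ultimately have F2: "has_bochner_integral (\<mu> \<Otimes>\<^sub>M N) (\<lambda>z. (?F z)\<^sup>2) I" by simp
  have "weak_conv_m (\<lambda>n. distr P borel (?S n)) (distr std_normal_distribution borel (\<lambda>x. 1 / (\<rho> * I) * sqrt I * x))"
    by (rule central_limit_theorem_scaled[OF meas]) (use F F2 I_pos in \<open>auto simp: has_bochner_integral_iff\<close>)
  \<comment> \<open>The summands have variance \<open>I\<close>; the scale 1/(\<rho> I) turns it
    into I / (\<rho> I)^2, the variance claimed.\<close>
  moreover have "sqrt (1 / (\<rho>\<^sup>2 * I)) = 1 / (\<rho> * I) * sqrt I"
    using \<rho> I_pos by (simp add: real_sqrt_divide real_sqrt_mult field_simps)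
  moreover have "0 < 1 / (\<rho>\<^sup>2 * I)" using \<rho> I_pos by simp
  ultimately show "weak_conv_m (\<lambda>n. distr P borel (?S n)) (Normal 0 (1 / (\<rho>\<^sup>2 * I)))"
    by (simp only: Normal_0_eq_distr)
  show "real_distribution (Normal 0 (1 / (\<rho>\<^sup>2 * I)))"
    using \<rho> I_pos prob_space_normal_density[of "sqrt (1 / (\<rho>\<^sup>2 * I))" 0]
    by (simp add: Normal_def real_distribution_def real_distribution_axioms_def)
  show "?S n \<in> borel_measurable P" for n
    using meas by measurable
  show "(\<lambda>\<omega>. sqrt (real n) * (\<theta> n \<omega> - a 0 / \<rho>)) \<in> borel_measurable P" for n
    by measurable
  let ?E = "\<lambda>n. expectation (\<lambda>\<omega>. min 1 \<bar>sqrt (real n) * (one_step n (m n) \<omega> - a 0 - efficient_average n \<omega>)\<bar>)"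
  have lim: "(\<lambda>n. (1 + 1 / \<rho>) * ?E n) \<longlonglongrightarrow> 0"
    using tendsto_mult_left[OF one_step_error_tendsto_0[OF m d], of "1 + 1 / \<rho>"] by simp
  show "(\<lambda>n. expectation (\<lambda>\<omega>. min 1 \<bar>sqrt (real n) * (\<theta> n \<omega> - a 0 / \<rho>) - ?S n \<omega>\<bar>)) \<longlonglongrightarrow> 0"
  proof (rule real_tendsto_sandwich[OF _ _ tendsto_const lim])
    show "\<forall>\<^sub>F n in sequentially. expectation (\<lambda>\<omega>. min 1 \<bar>sqrt (real n) * (\<theta> n \<omega> - a 0 / \<rho>) - ?S n \<omega>\<bar>)
        \<le> (1 + 1 / \<rho>) * ?E n"
      using eventually_gt_at_top[of 0]
    proof eventually_elim
      case (elim n)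
      have S: "?S n \<omega> = 1 / \<rho> * (sqrt (real n) * efficient_average n \<omega>)" for \<omega>
      proof -
        have "1 / sqrt (real n) = sqrt (real n) / real n"
          using elim by (simp add: field_simps)
        then have "(\<Sum>i<n. ?F (Z i \<omega>)) / sqrt (real n) = sqrt (real n) * avg n (\<lambda>i. ?F (Z i \<omega>))"
          by (metis (no_types) avg_def mult.commute times_divide_eq_left times_divide_eq_right mult_1)
        then show ?thesis
          by (simp add: efficient_average_def split_def mult.commute)
      qed
      have "expectation (\<lambda>\<omega>. min 1 \<bar>sqrt (real n) * (\<theta> n \<omega> - a 0 / \<rho>) - ?S n \<omega>\<bar>)
         \<le> expectation (\<lambda>\<omega>. (1 + 1 / \<rho>) * min 1 \<bar>sqrt (real n) * (one_step n (m n) \<omega> - a 0 - efficient_average n \<omega>)\<bar>)"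
      proof (rule integral_mono_AE)
        show "AE \<omega> in P. min 1 \<bar>sqrt (real n) * (\<theta> n \<omega> - a 0 / \<rho>) - ?S n \<omega>\<bar>
           \<le> (1 + 1 / \<rho>) * min 1 \<bar>sqrt (real n) * (one_step n (m n) \<omega> - a 0 - efficient_average n \<omega>)\<bar>"
          using \<theta>_eq[OF elim]
        proof eventually_elim
          case (elim \<omega>)
          let ?d = "sqrt (real n) * (one_step n (m n) \<omega> - a 0 - efficient_average n \<omega>)"
          have "sqrt (real n) * (\<theta> n \<omega> - a 0 / \<rho>) - ?S n \<omega> = 1 / \<rho> * ?d"
            unfolding S elim using \<rho> by (simp add: field_simps)
          then have "\<bar>sqrt (real n) * (\<theta> n \<omega> - a 0 / \<rho>) - ?S n \<omega>\<bar> = 1 / \<rho> * \<bar>?d\<bar>"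
            using \<rho> by (simp add: abs_mult)
          \<comment> \<open>The truncated distance is not homogeneous; the factor
            \<open>1 + 1 / \<rho>\<close> covers eigenvalues on either side of 1.\<close>
          moreover have "min 1 (1 / \<rho> * \<bar>d\<bar>) \<le> (1 + 1 / \<rho>) * min 1 \<bar>d\<bar>" for d
          proof (cases "\<bar>d\<bar> \<le> 1")
            case True
            have "min 1 (1 / \<rho> * \<bar>d\<bar>) \<le> 1 / \<rho> * \<bar>d\<bar>" by (rule min.cobounded2)
            also have "\<dots> \<le> (1 + 1 / \<rho>) * \<bar>d\<bar>" by (rule mult_right_mono) simp_all
            finally show ?thesis using True by simp
          next
            case False
            have "min 1 (1 / \<rho> * \<bar>d\<bar>) \<le> 1" by (rule min.cobounded1)
            also have "\<dots> \<le> 1 + 1 / \<rho>" using \<rho> by simp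
            finally show ?thesis using False by simp
          qed
          ultimately show ?case by simp
        qed
      qed (auto intro!: integrable_mult_right integrable_const_bound[of _ 1] simp: split_def)
      then show ?case by simp
    qed
  qed (auto intro!: always_eventually integral_nonneg_AE)
qed

end

section \<open>Operators between \<open>L\<^sup>2\<close> spaces\<close>

lemma L2_diff: "f \<in> L2 M \<Longrightarrow> g \<in> L2 M \<Longrightarrow> (\<lambda>x. f x - g x) \<in> L2 M"
  using L2_add[of f M "\<lambda>x. (-1) * g x"] L2_scale[of g M "-1"] by simp

lemma L2_norm_square: "(L2_norm M f)\<^sup>2 = (\<integral>x. (f x)\<^sup>2 \<partial>M)"
  by (simp add: L2_norm_def L2_inner_def power2_eq_square[symmetric] integral_nonneg_AE)

lemma L2_norm_nonneg: "0 \<le> L2_norm M f"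
  by (simp add: L2_norm_def L2_inner_def integral_nonneg_AE)

lemma L2_norm_eq_0_iff:
  assumes "f \<in> L2 M"
  shows "L2_norm M f = 0 \<longleftrightarrow> (AE x in M. f x = 0)"
proof -
  have "L2_norm M f = 0 \<longleftrightarrow> (\<integral>x. (f x)\<^sup>2 \<partial>M) = 0"
    using L2_norm_square[of M f] by (metis power_zero_numeral zero_eq_power2)
  also have "\<dots> \<longleftrightarrow> (AE x in M. (f x)\<^sup>2 = 0)"
    using assms by (intro integral_nonneg_eq_0_iff_AE) (auto simp: L2_def)
  finally show ?thesis by simp
qed

lemma L2_inner_cong_AE:
  assumes "AE x in M. f x = f' x" "AE x in M. g x = g' x"
    and "f \<in> borel_measurable M" "f' \<in> borel_measurable M" "g \<in> borel_measurable M" "g' \<in> borel_measurable M"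
  shows "L2_inner M f g = L2_inner M f' g'"
  unfolding L2_inner_def by (rule integral_cong_AE) (use assms in auto)

lemma L2_inner_diff_left:
  assumes "u \<in> L2 M" "v \<in> L2 M" "s \<in> L2 M"
  shows "L2_inner M (\<lambda>x. u x - v x) s = L2_inner M u s - L2_inner M v s"
  using L2_mult_integrable[OF assms(1,3)] L2_mult_integrable[OF assms(2,3)] unfolding L2_inner_def
  by (simp add: left_diff_distrib Bochner_Integration.integral_diff)

lemma L2_inner_commute: "L2_inner M f g = L2_inner M g f"
  by (simp add: L2_inner_def mult.commute)

lemma L2_inner_scale_right: "L2_inner M f (\<lambda>x. c * g x) = c * L2_inner M f g"
  by (simp add: L2_inner_def mult.left_commute)

lemma L2_operatorD:
  assumes "L2_operator M N T" "f \<in> L2 M"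
  shows "T f \<in> L2 N" and "g \<in> L2 M \<Longrightarrow> AE x in N. T (\<lambda>z. f z + g z) x = T f x + T g x"
    and "AE x in N. T (\<lambda>z. c * f z) x = c * T f x"
  using assms unfolding L2_operator_def by blast+

text \<open>Operators act on representatives, so this has to be proved: the difference has norm
  zero, and boundedness carries that over to its image.\<close>

lemma L2_operator_cong_AE:
  assumes T: "L2_operator M N T" and f: "f \<in> L2 M" and g: "g \<in> L2 M"
    and eq: "AE z in M. f z = g z"
  shows "AE x in N. T f x = T g x"
proof -
  let ?d = "\<lambda>z. f z + (-1) * g z"
  have g': "(\<lambda>z. (-1) * g z) \<in> L2 M" using g by (rule L2_scale)
  have d: "?d \<in> L2 M" using f g' by (rule L2_add)
  have "AE z in M. ?d z = 0" using eq by eventually_elim simp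
  then have "L2_norm M ?d = 0" using d L2_norm_eq_0_iff by blast
  moreover obtain C where "\<And>f. f \<in> L2 M \<Longrightarrow> L2_norm N (T f) \<le> C * L2_norm M f"
    using T unfolding L2_operator_def by blast
  ultimately have "L2_norm N (T ?d) = 0"
    using d L2_norm_nonneg[of N "T ?d"] by (metis mult_zero_right order_antisym)
  then have "AE x in N. T ?d x = 0" using L2_operatorD(1)[OF T d] L2_norm_eq_0_iff by blast
  with L2_operatorD(2)[OF T f g'] L2_operatorD(3)[OF T g, of "-1"] show ?thesis
    by eventually_elim simp
qed

text \<open>Pythagoras, one basis element at a time: the current remainder still has the full
  coefficient along \<open>\<phi> N\<close>, since the parts removed before are orthogonal to
  it.\<close>

lemma L2_orthonormal_square_remainder:
  assumes on: "L2_orthonormal M \<phi>" and f: "f \<in> L2 M"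
  shows "(\<integral>x. (f x - (\<Sum>k<N. L2_inner M f (\<phi> k) * \<phi> k x))\<^sup>2 \<partial>M)
    = (\<integral>x. (f x)\<^sup>2 \<partial>M) - (\<Sum>k<N. (L2_inner M f (\<phi> k))\<^sup>2)"
proof (induction N)
  case 0
  then show ?case by simp
next
  case (Suc N)
  let ?c = "\<lambda>k. L2_inner M f (\<phi> k)"
  have \<phi>: "\<phi> k \<in> L2 M" for k using on by (simp add: L2_orthonormal_def)
  have inner: "(\<integral>x. \<phi> j x * \<phi> k x \<partial>M) = (if j = k then 1 else 0)" for j k
    using on by (simp add: L2_orthonormal_def L2_inner_def)
  let ?r = "\<lambda>x. f x - (\<Sum>k<N. ?c k * \<phi> k x)"
  have "(\<lambda>x. \<Sum>k<N. ?c k * \<phi> k x) \<in> L2 M"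
  proof (cases N)
    case 0
    then show ?thesis by (simp add: L2_def)
  next
    case (Suc N')
    then show ?thesis using L2_lincomb[of \<phi> M ?c N', OF \<phi>] by (simp add: lessThan_Suc_atMost)
  qed
  then have r: "?r \<in> L2 M" by (rule L2_diff[OF f])
  have int: "integrable M (\<lambda>x. f x * \<phi> N x)" "integrable M (\<lambda>x. \<phi> k x * \<phi> N x)" for k
    using L2_mult_integrable f \<phi> by blast+
  have "(\<integral>x. ?r x * \<phi> N x \<partial>M) = (\<integral>x. f x * \<phi> N x - (\<Sum>k<N. ?c k * (\<phi> k x * \<phi> N x)) \<partial>M)"
    by (simp add: left_diff_distrib sum_distrib_right mult.assoc)
  also have "\<dots> = ?c N - (\<Sum>k<N. ?c k * (\<integral>x. \<phi> k x * \<phi> N x \<partial>M))"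
    using int by (simp add: L2_inner_def Bochner_Integration.integral_diff Bochner_Integration.integral_sum)
  finally have rN: "(\<integral>x. ?r x * \<phi> N x \<partial>M) = ?c N" by (simp add: inner)
  have "(\<integral>x. (f x - (\<Sum>k<Suc N. ?c k * \<phi> k x))\<^sup>2 \<partial>M)
      = (\<integral>x. (?r x)\<^sup>2 - 2 * ?c N * (?r x * \<phi> N x) + (?c N)\<^sup>2 * (\<phi> N x * \<phi> N x) \<partial>M)"
    by (rule Bochner_Integration.integral_cong) (simp_all add: power2_eq_square algebra_simps)
  also have "\<dots> = (\<integral>x. (?r x)\<^sup>2 \<partial>M) - 2 * ?c N * (\<integral>x. ?r x * \<phi> N x \<partial>M) + (?c N)\<^sup>2 * (\<integral>x. \<phi> N x * \<phi> N x \<partial>M)"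
    using r L2_mult_integrable[OF r \<phi>] int(2)
    by (simp add: L2_def)
  also have "\<dots> = (\<integral>x. (?r x)\<^sup>2 \<partial>M) - (?c N)\<^sup>2"
    unfolding rN inner by (simp add: power2_eq_square)
  finally show ?case using Suc.IH by simp
qed

lemma Parseval_tail:
  assumes basis: "L2_orthonormal_basis M \<phi>" and f: "f \<in> L2 M"
  shows "(\<integral>x. (f x - (\<Sum>k\<le>m. L2_inner M f (\<phi> k) * \<phi> k x))\<^sup>2 \<partial>M)
    = (\<Sum>k. (L2_inner M f (\<phi> (m + 1 + k)))\<^sup>2)"
proof -
  let ?c = "\<lambda>k. (L2_inner M f (\<phi> k))\<^sup>2"
  let ?E = "\<lambda>N. \<integral>x. (f x - (\<Sum>k<N. L2_inner M f (\<phi> k) * \<phi> k x))\<^sup>2 \<partial>M"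
  have on: "L2_orthonormal M \<phi>" using basis by (simp add: L2_orthonormal_basis_def)
  note E = L2_orthonormal_square_remainder[OF on f]
  have "(\<lambda>N. L2_norm M (\<lambda>x. f x - (\<Sum>k<N. L2_inner M f (\<phi> k) * \<phi> k x))) \<longlonglongrightarrow> 0"
    using basis f by (simp add: L2_orthonormal_basis_def)
  from tendsto_power[OF this, of 2] have "?E \<longlonglongrightarrow> 0" by (simp add: L2_norm_square)
  then have "(\<lambda>N. (\<integral>x. (f x)\<^sup>2 \<partial>M) - (\<Sum>k<N. ?c k)) \<longlonglongrightarrow> 0" unfolding E .
  from tendsto_diff[OF tendsto_const[of "\<integral>x. (f x)\<^sup>2 \<partial>M"] this]
  have sums: "?c sums (\<integral>x. (f x)\<^sup>2 \<partial>M)" by (simp add: sums_def)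
  \<comment> \<open>The truncation keeps the index m, so the tail starts at m + 1. Working with
    \<open>sums\<close> also establishes the convergence behind the infinite sum.\<close>
  have "(\<lambda>k. ?c (k + Suc m)) sums ((\<integral>x. (f x)\<^sup>2 \<partial>M) - (\<Sum>k<Suc m. ?c k))"
    using sums by (rule sums_split_initial_segment)
  then have "(\<Sum>k. ?c (m + 1 + k)) = (\<integral>x. (f x)\<^sup>2 \<partial>M) - (\<Sum>k<Suc m. ?c k)"
    by (simp add: sums_iff add.commute)
  then show ?thesis using E[of "Suc m"] by (simp only: lessThan_Suc_atMost)
qed

section \<open>Singular value expansion of \<open>K\<close> along the eigenbasis\<close>

locale polar_eigenbasis =
  fixes \<mu> :: "'x measure" and \<nu> :: "'z measure"
    and K V :: "('z \<Rightarrow> real) \<Rightarrow> ('x \<Rightarrow> real)"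
    and Kstar Vstar :: "('x \<Rightarrow> real) \<Rightarrow> ('z \<Rightarrow> real)"
    and R :: "('z \<Rightarrow> real) \<Rightarrow> ('z \<Rightarrow> real)"
    and \<phi> :: "nat \<Rightarrow> 'z \<Rightarrow> real" and \<rho> :: "nat \<Rightarrow> real"
  assumes K: "L2_operator \<nu> \<mu> K"
    and polar: "L2_polar_decomposition \<nu> \<mu> K Kstar V Vstar R"
    and basis: "L2_orthonormal_basis \<nu> \<phi>"
    and eigen: "\<And>k. AE z in \<nu>. R (\<phi> k) z = \<rho> k * \<phi> k z"
    and rho_pos: "\<And>k. 0 < \<rho> k"
begin

lemma orthonormal: "L2_orthonormal \<nu> \<phi>"
  using basis by (simp add: L2_orthonormal_basis_def)

lemma phi_L2: "\<phi> k \<in> L2 \<nu>"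
  using orthonormal by (simp add: L2_orthonormal_def)

lemma R_self_adjoint: "f \<in> L2 \<nu> \<Longrightarrow> g \<in> L2 \<nu> \<Longrightarrow> L2_inner \<nu> (R f) g = L2_inner \<nu> f (R g)"
  and R_operator: "L2_operator \<nu> \<nu> R"
  using polar by (auto simp: L2_polar_decomposition_def L2_positive_sqrt_def L2_adjoint_def)

lemma V_adjoint: "f \<in> L2 \<nu> \<Longrightarrow> g \<in> L2 \<mu> \<Longrightarrow> L2_inner \<mu> (V f) g = L2_inner \<nu> f (Vstar g)"
  and V_operator: "L2_operator \<nu> \<mu> V" and Vstar_operator: "L2_operator \<mu> \<nu> Vstar"
  using polar by (auto simp: L2_polar_decomposition_def L2_partial_isometry_def L2_adjoint_def)

lemma K_eq: "f \<in> L2 \<nu> \<Longrightarrow> AE x in \<mu>. K f x = V (R f) x"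
  and Vstar_V_R: "f \<in> L2 \<nu> \<Longrightarrow> AE z in \<nu>. Vstar (V (R f)) z = R f z"
  using polar by (auto simp: L2_polar_decomposition_def)

lemma V_R_phi: "AE x in \<mu>. V (R (\<phi> k)) x = \<rho> k * V (\<phi> k) x"
proof -
  have "AE x in \<mu>. V (R (\<phi> k)) x = V (\<lambda>z. \<rho> k * \<phi> k z) x"
    by (intro L2_operator_cong_AE[OF V_operator] L2_operatorD(1)[OF R_operator] L2_scale phi_L2 eigen)
  with L2_operatorD(3)[OF V_operator phi_L2, of "\<rho> k" k] show ?thesis
    by eventually_elim simp
qed

lemma K_phi: "AE x in \<mu>. K (\<phi> k) x = \<rho> k * V (\<phi> k) x"
  using K_eq[OF phi_L2[of k]] V_R_phi[of k] by eventually_elim simp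

lemma V_phi_L2: "V (\<phi> k) \<in> L2 \<mu>"
  by (rule L2_operatorD(1)[OF V_operator phi_L2])

text \<open>\<open>Vstar\<close> undoes \<open>V\<close> on the range of \<open>R\<close>, and
  \<open>\<phi> k\<close> lies in that range because its eigenvalue is positive. Orthonormality of
  the \<open>V (\<phi> k)\<close> follows from this by the adjoint relation.\<close>

lemma Vstar_V_phi: "AE z in \<nu>. Vstar (V (\<phi> k)) z = \<phi> k z"
proof -
  have "AE z in \<nu>. Vstar (V (R (\<phi> k))) z = Vstar (\<lambda>x. \<rho> k * V (\<phi> k) x) z"
    by (intro L2_operator_cong_AE[OF Vstar_operator] L2_operatorD(1)[OF V_operator]
        L2_operatorD(1)[OF R_operator] L2_scale V_phi_L2 V_R_phi phi_L2)
  with L2_operatorD(3)[OF Vstar_operator V_phi_L2, of "\<rho> k" k] Vstar_V_R[OF phi_L2[of k]] eigen[of k]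
  show ?thesis
    by eventually_elim (use rho_pos[of k] in auto)
qed

lemma inner_Vstar_V_phi: "f \<in> L2 \<nu> \<Longrightarrow> L2_inner \<nu> f (Vstar (V (\<phi> k))) = L2_inner \<nu> f (\<phi> k)"
  by (rule L2_inner_cong_AE)
    (use Vstar_V_phi phi_L2 L2_operatorD(1)[OF Vstar_operator V_phi_L2] in \<open>auto simp: L2_def\<close>)

lemma V_phi_orthonormal: "L2_inner \<mu> (V (\<phi> j)) (V (\<phi> k)) = (if j = k then 1 else 0)"
  using V_adjoint[OF phi_L2 V_phi_L2] inner_Vstar_V_phi[OF phi_L2] orthonormal
  by (simp add: L2_orthonormal_def)

text \<open>Identifies the regression coefficients a_k: \<open>K\<close> is \<open>V\<close> after
  \<open>R\<close>, \<open>V\<close> disappears against \<open>V (\<phi> k)\<close>, and the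
  self-adjoint \<open>R\<close> is moved onto its eigenfunction.\<close>

lemma inner_K_V_phi:
  assumes f: "f \<in> L2 \<nu>"
  shows "L2_inner \<mu> (K f) (V (\<phi> k)) = \<rho> k * L2_inner \<nu> f (\<phi> k)"
proof -
  have Rf: "R f \<in> L2 \<nu>" by (rule L2_operatorD(1)[OF R_operator f])
  have "L2_inner \<mu> (K f) (V (\<phi> k)) = L2_inner \<mu> (V (R f)) (V (\<phi> k))"
    using K_eq[OF f] V_phi_L2[of k] L2_operatorD(1)[OF V_operator Rf] L2_operatorD(1)[OF K f]
    by (intro L2_inner_cong_AE) (auto simp: L2_def)
  also have "\<dots> = L2_inner \<nu> (R f) (\<phi> k)"
    using V_adjoint[OF Rf V_phi_L2] inner_Vstar_V_phi[OF Rf] by simp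
  also have "\<dots> = L2_inner \<nu> f (R (\<phi> k))" by (rule R_self_adjoint[OF f phi_L2])
  also have "\<dots> = L2_inner \<nu> f (\<lambda>z. \<rho> k * \<phi> k z)"
    using eigen[of k] f phi_L2[of k] L2_operatorD(1)[OF R_operator phi_L2[of k]]
    by (intro L2_inner_cong_AE) (auto simp: L2_def)
  finally show ?thesis by (simp add: L2_inner_scale_right)
qed

text \<open>The truncation remainder of \<open>K f\<close> is the image under \<open>K\<close> of
  the truncation remainder of \<open>f\<close>, so the squared operator bound times the Parseval
  tail works for every \<open>m\<close> at once.\<close>

lemma K_remainder_bound:
  assumes f: "f \<in> L2 \<nu>"
  shows "\<exists>C. \<forall>m. (\<integral>x. (K f x - (\<Sum>k\<le>m. \<rho> k * L2_inner \<nu> f (\<phi> k) * V (\<phi> k) x))\<^sup>2 \<partial>\<mu>)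
    \<le> C * (\<Sum>k. (L2_inner \<nu> f (\<phi> (m + 1 + k)))\<^sup>2)"
proof -
  obtain C where C: "\<And>f. f \<in> L2 \<nu> \<Longrightarrow> L2_norm \<mu> (K f) \<le> C * L2_norm \<nu> f"
    using K unfolding L2_operator_def by blast
  have "(\<integral>x. (K f x - (\<Sum>k\<le>m. \<rho> k * L2_inner \<nu> f (\<phi> k) * V (\<phi> k) x))\<^sup>2 \<partial>\<mu>)
        \<le> C\<^sup>2 * (\<Sum>k. (L2_inner \<nu> f (\<phi> (m + 1 + k)))\<^sup>2)" for m
  proof -
    \<comment> \<open>The sign sits in the coefficients, since additivity of operators is available
      for sums only.\<close>
    let ?c = "\<lambda>k. - L2_inner \<nu> f (\<phi> k)"
    let ?h = "\<lambda>z. \<Sum>k\<le>m. ?c k * \<phi> k z"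
    let ?r = "\<lambda>z. f z + ?h z"
    have h: "?h \<in> L2 \<nu>" by (rule L2_lincomb) (rule phi_L2)
    have r: "?r \<in> L2 \<nu>" using f h by (rule L2_add)
    have "AE x in \<mu>. \<forall>k. K (\<phi> k) x = \<rho> k * V (\<phi> k) x"
      using K_phi by (simp add: AE_all_countable)
    with L2_operatorD(2)[OF K f h] L2_operator_lincomb[where \<phi> = \<phi> and c = ?c and m = m, OF K phi_L2]
    have "AE x in \<mu>. K ?r x = K f x - (\<Sum>k\<le>m. \<rho> k * L2_inner \<nu> f (\<phi> k) * V (\<phi> k) x)"
      by eventually_elim (simp add: sum_negf mult_ac)
    moreover have [measurable]: "V (\<phi> k) \<in> borel_measurable \<mu>" "K f \<in> borel_measurable \<mu>"
        "K ?r \<in> borel_measurable \<mu>" for k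
      using L2_operatorD(1)[OF K f] L2_operatorD(1)[OF K r] V_phi_L2[of k] by (simp_all add: L2_def)
    ultimately have "(\<integral>x. (K f x - (\<Sum>k\<le>m. \<rho> k * L2_inner \<nu> f (\<phi> k) * V (\<phi> k) x))\<^sup>2 \<partial>\<mu>) = (\<integral>x. (K ?r x)\<^sup>2 \<partial>\<mu>)"
      by (intro integral_cong_AE) auto
    also have "\<dots> = (L2_norm \<mu> (K ?r))\<^sup>2" by (simp add: L2_norm_square)
    also have "\<dots> \<le> (C * L2_norm \<nu> ?r)\<^sup>2"
      by (rule power_mono[OF C[OF r] L2_norm_nonneg])
    also have "\<dots> = C\<^sup>2 * (\<integral>z. (f z - (\<Sum>k\<le>m. L2_inner \<nu> f (\<phi> k) * \<phi> k z))\<^sup>2 \<partial>\<nu>)"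
      by (simp add: power_mult_distrib L2_norm_square sum_negf)
    finally show ?thesis unfolding Parseval_tail[OF basis f] .
  qed
  then show ?thesis by blast
qed

text \<open>The preimage is \<open>c / \<rho> k\<close> times \<open>\<phi> k\<close>. Its image
  agrees with the function only almost everywhere, which is distance zero and hence enough for the
  closure.\<close>

lemma V_phi_range_closure: "(\<lambda>x. c * V (\<phi> k) x) \<in> L2_range_closure \<nu> \<mu> K"
proof -
  let ?f = "\<lambda>z. c / \<rho> k * \<phi> k z"
  have f: "?f \<in> L2 \<nu>" by (rule L2_scale[OF phi_L2])
  have v: "(\<lambda>x. c * V (\<phi> k) x) \<in> L2 \<mu>" by (rule L2_scale[OF V_phi_L2])
  have "AE x in \<mu>. c * V (\<phi> k) x - K ?f x = 0"
    using L2_operatorD(3)[OF K phi_L2, of "c / \<rho> k" k] K_phi[of k]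
    by eventually_elim (use rho_pos[of k] in simp)
  then have "L2_norm \<mu> (\<lambda>x. c * V (\<phi> k) x - K ?f x) = 0"
    using L2_norm_eq_0_iff[OF L2_diff[OF v L2_operatorD(1)[OF K f]]] by simp
  then have "L2_norm \<mu> (\<lambda>x. c * V (\<phi> k) x - K ?f x) < e" if "0 < e" for e using that by simp
  with f v show ?thesis unfolding L2_range_closure_def by blast
qed

end

section \<open>Projection of the gradient and the optimal variance\<close>

lemma L2_projection_norm:
  assumes v: "L2_is_projection M S u v"
  shows "(L2_norm M (L2_projection M S u))\<^sup>2 = (L2_norm M v)\<^sup>2"
proof -
  define v' where "v' = L2_projection M S u"
  have v': "L2_is_projection M S u v'"
    unfolding v'_def L2_projection_def by (rule someI[where P = "L2_is_projection M S u", OF v])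
  \<comment> \<open>The projection is an arbitrary choice among representatives. Two candidates lie
    in \<open>S\<close> and can be tested against each other, so both have squared norm equal to
    their mutual inner product.\<close>
  have eq: "L2_inner M u s = L2_inner M p s"
    if p: "L2_is_projection M S u p" and s: "s \<in> S" "s \<in> L2 M" for p s
    using p s L2_inner_diff_left[of u M p s] by (simp add: L2_is_projection_def)
  have "v \<in> S" "v \<in> L2 M" "v' \<in> S" "v' \<in> L2 M" using v v' by (auto simp: L2_is_projection_def)
  then have "L2_inner M v v = L2_inner M v' v'"
    using eq[OF v, of v] eq[OF v', of v] eq[OF v, of v'] eq[OF v', of v'] L2_inner_commute[of M v v'] by simp
  then show ?thesis unfolding v'_def[symmetric] by (simp add: L2_norm_def)
qed

text \<open>For fixed \<open>x\<close> the substitution of y - g x for y removes the regression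
  function from the inner integral, so geometry on the product space splits into geometry on the two
  factors.\<close>

lemma (in prob_space) shifted_product_inner:
  fixes g :: "'a \<Rightarrow> real" and p q :: "real \<Rightarrow> real"
  assumes [measurable]: "g \<in> borel_measurable M"
    and p: "p \<in> L2 lborel" and q: "q \<in> L2 lborel" and h: "h \<in> L2 M" and k: "k \<in> L2 M"
  shows "has_bochner_integral (M \<Otimes>\<^sub>M lborel) (\<lambda>(x, y). p (y - g x) * h x * (q (y - g x) * k x))
      (L2_inner M h k * L2_inner lborel p q)"
proof -
  interpret pair_sigma_finite M lborel ..
  have [measurable]: "p \<in> borel_measurable borel" "q \<in> borel_measurable borel"
    using p q by (auto simp: L2_def)
  have pq: "integrable lborel (\<lambda>y. p y * q y)" using p q by (rule L2_mult_integrable)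
  have shift: "integrable lborel (\<lambda>y. r (y - t))" "(\<integral>y. r (y - t) \<partial>lborel) = (\<integral>y. r y \<partial>lborel)"
    if "integrable lborel r" for r :: "real \<Rightarrow> real" and t
    using lborel_integrable_real_affine[OF that, of 1 "- t"] lborel_integral_real_affine[of 1 r "- t"] by auto
  have "integrable lborel (\<lambda>y. \<bar>p y * q y\<bar>)" using pq by (rule integrable_abs)
  note shift_abs = shift[OF this]
  have "has_bochner_integral (M \<Otimes>\<^sub>M lborel) (\<lambda>(x, y). h x * k x * (p (y - g x) * q (y - g x)))
      ((\<integral>x. h x * k x \<partial>M) * (\<integral>y. p y * q y \<partial>lborel))"
    by (rule has_bochner_integral_product_fiber[where B = "\<integral>y. \<bar>p y * q y\<bar> \<partial>lborel"])
      (auto simp: shift[OF pq] shift_abs intro: L2_mult_integrable[OF h k])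
  moreover have "(\<lambda>(x, y). h x * k x * (p (y - g x) * q (y - g x))) = (\<lambda>(x, y). p (y - g x) * h x * (q (y - g x) * k x))"
    by (auto simp: fun_eq_iff)
  ultimately show ?thesis by (simp add: L2_inner_def)
qed

lemma (in prob_space) shifted_product:
  fixes g :: "'a \<Rightarrow> real" and p q :: "real \<Rightarrow> real"
  assumes g[measurable]: "g \<in> borel_measurable M"
    and p: "p \<in> L2 lborel" and q: "q \<in> L2 lborel" and h: "h \<in> L2 M" and k: "k \<in> L2 M"
  shows shifted_product_L2: "(\<lambda>(x, y). p (y - g x) * h x) \<in> L2 (M \<Otimes>\<^sub>M lborel)"
    and shifted_product_L2_inner: "L2_inner (M \<Otimes>\<^sub>M lborel) (\<lambda>(x, y). p (y - g x) * h x) (\<lambda>(x, y). q (y - g x) * k x)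
      = L2_inner M h k * L2_inner lborel p q"
proof -
  have [measurable]: "p \<in> borel_measurable borel" "h \<in> borel_measurable M"
    using p h by (auto simp: L2_def)
  have eq: "(\<lambda>z. (case z of (x, y) \<Rightarrow> p (y - g x) * h x)\<^sup>2) = (\<lambda>(x, y). p (y - g x) * h x * (p (y - g x) * h x))"
    by (auto simp: fun_eq_iff power2_eq_square)
  show "(\<lambda>(x, y). p (y - g x) * h x) \<in> L2 (M \<Otimes>\<^sub>M lborel)"
    unfolding L2_def mem_Collect_eq eq using shifted_product_inner[OF g p p h h]
    by (auto simp: has_bochner_integral_iff)
  show "L2_inner (M \<Otimes>\<^sub>M lborel) (\<lambda>(x, y). p (y - g x) * h x) (\<lambda>(x, y). q (y - g x) * k x)
      = L2_inner M h k * L2_inner lborel p q"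
    using shifted_product_inner[OF g p q h k]
    by (simp add: L2_inner_def[of "M \<Otimes>\<^sub>M lborel"] has_bochner_integral_iff split_def)
qed

locale smooth_density =
  fixes \<psi> :: "real \<Rightarrow> real"
  assumes psi_pos: "\<And>y. 0 < \<psi> y"
    and psi_diff: "\<And>y. \<psi> differentiable at y" "\<And>y. deriv \<psi> differentiable at y"
    and psi_integrable: "integrable lborel \<psi>" and psi_integral: "(\<integral>y. \<psi> y \<partial>lborel) = 1"
    and psi_square: "integrable lborel (\<lambda>y. y\<^sup>2 * \<psi> y)"
    and fisher_finite: "integrable lborel (\<lambda>y. (deriv \<psi> y / \<psi> y)\<^sup>2 * \<psi> y)"
begin

lemma psi_measurable [measurable]: "\<psi> \<in> borel_measurable borel" "deriv \<psi> \<in> borel_measurable borel"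
  using psi_diff by (auto intro!: borel_measurable_continuous_onI simp: continuous_on_eq_continuous_at
      differentiable_imp_continuous_within)

lemma has_deriv_psi: "(\<psi> has_real_derivative deriv \<psi> y) (at y)"
  using psi_diff(1) by (simp add: DERIV_deriv_iff_real_differentiable)

lemma continuous_psi: "continuous_on UNIV \<psi>" "continuous_on UNIV (deriv \<psi>)"
  using psi_diff by (auto simp: continuous_on_eq_continuous_at differentiable_imp_continuous_within)

text \<open>Minus the derivative of \<surd>\<psi>; the tangent vector in direction h is its
  translate by the regression function, times h.\<close>

definition root_score :: "real \<Rightarrow> real" where
  "root_score y = - (deriv \<psi> y / (2 * sqrt (\<psi> y)))"

lemma root_score_square: "(root_score y)\<^sup>2 = 1 / 4 * ((deriv \<psi> y / \<psi> y)\<^sup>2 * \<psi> y)"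
  using psi_pos[of y] by (simp add: root_score_def power_divide power_mult_distrib power2_eq_square field_simps)

lemma root_psi_L2: "(\<lambda>y. sqrt (\<psi> y)) \<in> L2 lborel"
  and mult_root_psi_L2: "(\<lambda>y. y * sqrt (\<psi> y)) \<in> L2 lborel"
  and root_score_L2: "root_score \<in> L2 lborel"
proof -
  show "(\<lambda>y. sqrt (\<psi> y)) \<in> L2 lborel"
    using psi_pos psi_integrable by (simp add: L2_def less_imp_le)
  show "(\<lambda>y. y * sqrt (\<psi> y)) \<in> L2 lborel"
    using psi_pos psi_square by (simp add: L2_def less_imp_le power_mult_distrib)
  show "root_score \<in> L2 lborel"
    using fisher_finite unfolding L2_def mem_Collect_eq root_score_square
    by (auto simp: root_score_def[abs_def])
qed

lemma deriv_psi_eq: "deriv \<psi> y = - 2 * (sqrt (\<psi> y) * root_score y)"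
  using psi_pos[of y] by (simp add: root_score_def)

text \<open>Both functions are products of two square-integrable ones: finite Fisher information
  handles the factor \<open>root_score\<close>, total mass and second moment of
  \<open>\<psi>\<close> the other factor.\<close>

lemma integrable_deriv_psi: "integrable lborel (deriv \<psi>)"
  and integrable_mult_deriv_psi: "integrable lborel (\<lambda>y. y * deriv \<psi> y)"
proof -
  have "integrable lborel (\<lambda>y. - 2 * (sqrt (\<psi> y) * root_score y))"
    by (intro integrable_mult_right L2_mult_integrable root_psi_L2 root_score_L2)
  then show "integrable lborel (deriv \<psi>)" by (simp only: deriv_psi_eq[symmetric])
  have "integrable lborel (\<lambda>y. - 2 * ((y * sqrt (\<psi> y)) * root_score y))"
    by (intro integrable_mult_right L2_mult_integrable mult_root_psi_L2 root_score_L2)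
  moreover have "- 2 * ((y * sqrt (\<psi> y)) * root_score y) = y * deriv \<psi> y" for y
    using deriv_psi_eq[of y] by simp
  ultimately show "integrable lborel (\<lambda>y. y * deriv \<psi> y)" by (simp only:)
qed

lemma integral_deriv_psi: "(\<integral>y. deriv \<psi> y \<partial>lborel) = 0"
  by (rule integral_deriv_eq_0[OF psi_integrable integrable_deriv_psi has_deriv_psi continuous_psi(2)])

text \<open>Integration by parts without boundary terms: the derivative of y \<psi>(y) is
  integrable, hence has integral zero, and its part \<psi> has integral 1.\<close>

lemma integral_mult_deriv_psi: "(\<integral>y. y * deriv \<psi> y \<partial>lborel) = - 1"
proof -
  have "integrable lborel (\<lambda>y. (y * sqrt (\<psi> y)) * sqrt (\<psi> y))"
    by (intro L2_mult_integrable mult_root_psi_L2 root_psi_L2)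
  then have F: "integrable lborel (\<lambda>y. y * \<psi> y)"
    using psi_pos by (simp add: mult.assoc less_imp_le)
  have F': "integrable lborel (\<lambda>y. \<psi> y + y * deriv \<psi> y)"
    using psi_integrable integrable_mult_deriv_psi by simp
  have "(\<integral>y. \<psi> y + y * deriv \<psi> y \<partial>lborel) = 0"
  proof (rule integral_deriv_eq_0[OF F F'])
    show "((\<lambda>y. y * \<psi> y) has_real_derivative \<psi> y + y * deriv \<psi> y) (at y)" for y
      by (auto intro!: derivative_eq_intros has_deriv_psi)
    show "continuous_on UNIV (\<lambda>y. \<psi> y + y * deriv \<psi> y)"
      by (intro continuous_intros continuous_psi)
  qed
  then show ?thesis using psi_integrable integrable_mult_deriv_psi by (simp add: psi_integral)
qed

lemma inner_root_score:
  "L2_inner lborel root_score root_score = fisher_information \<psi> / 4"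
  "L2_inner lborel (\<lambda>y. y * sqrt (\<psi> y)) root_score = 1 / 2"
proof -
  show "L2_inner lborel root_score root_score = fisher_information \<psi> / 4"
    by (simp add: L2_inner_def fisher_information_def root_score_square power2_eq_square[symmetric]
        del: times_divide_eq_left)
  have "(y * sqrt (\<psi> y)) * root_score y = - 1 / 2 * (y * deriv \<psi> y)" for y
    using deriv_psi_eq[of y] by simp
  then show "L2_inner lborel (\<lambda>y. y * sqrt (\<psi> y)) root_score = 1 / 2"
    by (simp add: L2_inner_def integral_mult_deriv_psi)
qed

text \<open>Otherwise \<open>root_score\<close> would vanish almost everywhere, contradicting its
  inner product 1/2 with y \<surd>\<psi>(y).\<close>

lemma fisher_information_pos: "0 < fisher_information \<psi>"
proof (rule ccontr)
  assume "\<not> 0 < fisher_information \<psi>"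
  moreover have "0 \<le> L2_inner lborel root_score root_score"
    by (simp add: L2_inner_def integral_nonneg_AE)
  ultimately have "L2_norm lborel root_score = 0"
    by (simp add: L2_norm_def inner_root_score)
  then have "AE y in lborel. root_score y = 0" using L2_norm_eq_0_iff[OF root_score_L2] by simp
  then have "AE y in lborel. (y * sqrt (\<psi> y)) * root_score y = 0" by eventually_elim simp
  then have "L2_inner lborel (\<lambda>y. y * sqrt (\<psi> y)) root_score = 0"
    unfolding L2_inner_def by (rule integral_eq_zero_AE)
  then show False by (simp add: inner_root_score)
qed

lemma optimal_variance_eq:
  assumes mu: "prob_space \<mu>" and Kf: "K f \<in> L2 \<mu>" and \<rho>: "0 < \<rho>0"
    and v0: "v0 \<in> L2 \<mu>" "L2_inner \<mu> v0 v0 = 1"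
    and range: "\<And>c. (\<lambda>x. c * v0 x) \<in> L2_range_closure \<nu> \<mu> K"
  shows "optimal_variance \<nu> \<mu> K \<psi> \<rho>0 v0 f = 1 / (\<rho>0\<^sup>2 * fisher_information \<psi>)"
proof -
  interpret prob_space \<mu> by (rule mu)
  let ?I = "fisher_information \<psi>" and ?g = "K f"
  note I = fisher_information_pos
  have g: "?g \<in> borel_measurable \<mu>" using Kf by (simp add: L2_def)
  \<comment> \<open>Against the tangent vector of h, the gradient gives (2/\<rho>0)(1/2) and the
    tangent vector of c v0 gives c I/4, each times the inner product of v0 with h. Equating them
    determines \<open>c\<close>; the squared norm c^2 I/4, divided by 4, is then the
    variance.\<close>
  define c where "c = 4 / (\<rho>0 * ?I)"
  have tangent: "tangent_vector \<psi> ?g h = (\<lambda>(x, y). root_score (y - ?g x) * h x)" for h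
    by (auto simp: tangent_vector_def root_density_def root_score_def fun_eq_iff)
  have gradient: "functional_gradient \<psi> ?g \<rho>0 v0
      = (\<lambda>(x, y). ((y - ?g x) * sqrt (\<psi> (y - ?g x))) * (2 / \<rho>0 * v0 x))"
    by (auto simp: functional_gradient_def root_density_def fun_eq_iff)
  have cv: "(\<lambda>x. c * v0 x) \<in> L2 \<mu>" "(\<lambda>x. 2 / \<rho>0 * v0 x) \<in> L2 \<mu>" by (rule L2_scale[OF v0(1)])+
  have inner: "L2_inner \<mu> (\<lambda>x. t * v0 x) h = t * L2_inner \<mu> v0 h" for t h
    by (simp add: L2_inner_def mult.assoc)
  have proj: "L2_is_projection (\<mu> \<Otimes>\<^sub>M lborel) (tangent_space \<nu> \<mu> K \<psi> f) (functional_gradient \<psi> ?g \<rho>0 v0)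
      (tangent_vector \<psi> ?g (\<lambda>x. c * v0 x))"
    unfolding L2_is_projection_def
  proof (intro conjI ballI)
    show u: "functional_gradient \<psi> ?g \<rho>0 v0 \<in> L2 (\<mu> \<Otimes>\<^sub>M lborel)"
      unfolding gradient by (rule shifted_product_L2[OF g mult_root_psi_L2 mult_root_psi_L2 cv(2) cv(2)])
    show v: "tangent_vector \<psi> ?g (\<lambda>x. c * v0 x) \<in> L2 (\<mu> \<Otimes>\<^sub>M lborel)"
      unfolding tangent by (rule shifted_product_L2[OF g root_score_L2 root_score_L2 cv(1) cv(1)])
    show "tangent_vector \<psi> ?g (\<lambda>x. c * v0 x) \<in> tangent_space \<nu> \<mu> K \<psi> f"
      unfolding tangent_space_def using range by blast
    fix s assume "s \<in> tangent_space \<nu> \<mu> K \<psi> f"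
    then obtain h where s: "s = tangent_vector \<psi> ?g h" and h: "h \<in> L2 \<mu>"
      by (auto simp: tangent_space_def L2_range_closure_def)
    have sL2: "s \<in> L2 (\<mu> \<Otimes>\<^sub>M lborel)"
      unfolding s tangent by (rule shifted_product_L2[OF g root_score_L2 root_score_L2 h h])
    have "L2_inner (\<mu> \<Otimes>\<^sub>M lborel) (functional_gradient \<psi> ?g \<rho>0 v0) s = 1 / \<rho>0 * L2_inner \<mu> v0 h"
      unfolding gradient s tangent shifted_product_L2_inner[OF g mult_root_psi_L2 root_score_L2 cv(2) h]
      by (simp only: inner inner_root_score) simp
    moreover have "L2_inner (\<mu> \<Otimes>\<^sub>M lborel) (tangent_vector \<psi> ?g (\<lambda>x. c * v0 x)) s = 1 / \<rho>0 * L2_inner \<mu> v0 h"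
      unfolding s tangent shifted_product_L2_inner[OF g root_score_L2 root_score_L2 cv(1) h]
      using I by (simp only: inner inner_root_score) (simp add: c_def)
    ultimately show "L2_inner (\<mu> \<Otimes>\<^sub>M lborel)
       (\<lambda>x. functional_gradient \<psi> ?g \<rho>0 v0 x - tangent_vector \<psi> ?g (\<lambda>x. c * v0 x) x) s = 0"
      using L2_inner_diff_left[OF u v sL2] by simp
  qed
  have "(L2_norm (\<mu> \<Otimes>\<^sub>M lborel) (tangent_vector \<psi> ?g (\<lambda>x. c * v0 x)))\<^sup>2
     = L2_inner (\<mu> \<Otimes>\<^sub>M lborel) (tangent_vector \<psi> ?g (\<lambda>x. c * v0 x)) (tangent_vector \<psi> ?g (\<lambda>x. c * v0 x))"
    by (simp add: L2_norm_def L2_inner_def integral_nonneg_AE)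
  also have "\<dots> = c\<^sup>2 * (?I / 4)"
    unfolding tangent shifted_product_L2_inner[OF g root_score_L2 root_score_L2 cv(1) cv(1)]
    by (simp add: inner L2_inner_scale_right v0(2) inner_root_score power2_eq_square)
  also have "1 / 4 * \<dots> = 1 / (\<rho>0\<^sup>2 * ?I)"
    using I \<rho> by (simp add: c_def power2_eq_square field_simps)
  finally show ?thesis
    unfolding optimal_variance_def L2_projection_norm[OF proj] by simp
qed

end

section \<open>Reduction of the operator problem to the regression model\<close>

lemma (in prob_space) indep_rvs_pair_distr:
  assumes "indep_rvs M S A T B"
  shows "distr M S A \<Otimes>\<^sub>M distr M T B = distr M (S \<Otimes>\<^sub>M T) (\<lambda>q. (A q, B q))"
proof -
  have [measurable]: "A \<in> measurable M S" "B \<in> measurable M T"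
    and ind: "indep_set {A -` U \<inter> space M | U. U \<in> sets S} {B -` U \<inter> space M | U. U \<in> sets T}"
    using assms by (auto simp: indep_rvs_def)
  interpret A: prob_space "distr M S A" by (rule prob_space_distr) simp
  interpret B: prob_space "distr M T B" by (rule prob_space_distr) simp
  show ?thesis
  proof (rule pair_measure_eqI)
    fix U W assume "U \<in> sets (distr M S A)" "W \<in> sets (distr M T B)"
    then have [measurable]: "U \<in> sets S" "W \<in> sets T" by simp_all
    have "prob ((A -` U \<inter> space M) \<inter> (B -` W \<inter> space M)) = prob (A -` U \<inter> space M) * prob (B -` W \<inter> space M)"
      by (rule indep_setD[OF ind]) auto
    moreover have "(A -` U \<inter> space M) \<inter> (B -` W \<inter> space M) = (\<lambda>q. (A q, B q)) -` (U \<times> W) \<inter> space M"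
      by auto
    ultimately show "emeasure (distr M S A) U * emeasure (distr M T B) W
        = emeasure (distr M (S \<Otimes>\<^sub>M T) (\<lambda>q. (A q, B q))) (U \<times> W)"
      by (simp add: emeasure_distr emeasure_eq_measure ennreal_mult'')
  qed (unfold_locales, simp cong: sets_pair_measure_cong)
qed

lemma (in regression_sample) AE_sample_fst:
  assumes "AE x in \<mu>. A x"
  shows "AE \<omega> in P. A (fst (Z i \<omega>))"
proof -
  have "AE x in distr (\<mu> \<Otimes>\<^sub>M N) \<mu> fst. A x"
    using assms unfolding N.distr_pair_fst .
  then have "AE z in \<mu> \<Otimes>\<^sub>M N. A (fst z)" by (rule AE_distrD[OF measurable_fst])
  then show ?thesis by (rule AE_sample)
qed

text \<open>Holds at every point \<open>x\<close>, without an exceptional set, so the random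
  coefficients and the random evaluation point may depend on each other.\<close>

lemma (in polar_eigenbasis) span_version_series_estimator:
  "span_version \<nu> \<phi> m K (series_estimator \<phi> \<rho> v X Y n m \<omega>) x
    = (\<Sum>k\<le>m. coeff_estimator \<rho> v X Y n k \<omega> * K (\<phi> k) x)"
  using L2_inner_lincomb[OF orthonormal, where c = "\<lambda>k. coeff_estimator \<rho> v X Y n k \<omega>"]
  by (simp add: span_version_def series_estimator_def[abs_def])

theorem mainTheorem1:
  fixes \<mu> :: "'x measure" and \<nu> :: "'z measure"
    and K V :: "('z \<Rightarrow> real) \<Rightarrow> ('x \<Rightarrow> real)"
    and Kstar Vstar :: "('x \<Rightarrow> real) \<Rightarrow> ('z \<Rightarrow> real)"
    and R :: "('z \<Rightarrow> real) \<Rightarrow> ('z \<Rightarrow> real)"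
    and \<phi> :: "nat \<Rightarrow> 'z \<Rightarrow> real" and \<rho> :: "nat \<Rightarrow> real" and \<phi>V :: "nat \<Rightarrow> 'x \<Rightarrow> real"
    and f :: "'z \<Rightarrow> real" and fc :: "nat \<Rightarrow> real"
    and Q :: "'q measure" and X0 :: "'q \<Rightarrow> 'x" and Y0 eps :: "'q \<Rightarrow> real"
    and P :: "'w measure" and X :: "nat \<Rightarrow> 'w \<Rightarrow> 'x" and Y :: "nat \<Rightarrow> 'w \<Rightarrow> real"
    and \<psi> :: "real \<Rightarrow> real" and \<sigma> :: real and m :: "nat \<Rightarrow> nat"
  assumes mu: "emeasure \<mu> (space \<mu>) = 1"
    and sep_mu: "L2_separable \<mu>" and sep_nu: "L2_separable \<nu>"
    and K: "L2_operator \<nu> \<mu> K" and K_inj: "L2_injective \<nu> \<mu> K"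
    and Kstar: "L2_adjoint \<nu> \<mu> K Kstar"
    and polar: "L2_polar_decomposition \<nu> \<mu> K Kstar V Vstar R"
    and basis: "L2_orthonormal_basis \<nu> \<phi>"
    and eigen: "\<And>k. AE z in \<nu>. R (\<phi> k) z = \<rho> k * \<phi> k z"
    and rho_pos: "\<And>k. 0 < \<rho> k" and rho_bdd: "bdd_above (range \<rho>)"
    and phiV: "\<And>k. \<phi>V k = V (\<phi> k)"
    and phi_bdd: "bdd_above {\<bar>\<phi> k z\<bar> | k z. z \<in> space \<nu>}"
    and phiV_bdd: "bdd_above {\<bar>\<phi>V k x\<bar> | k x. x \<in> space \<mu>}"
    and f: "f \<in> L2 \<nu>" and fc: "\<And>k. fc k = L2_inner \<nu> f (\<phi> k)"
    and Q: "prob_space Q"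
    and X0: "X0 \<in> measurable Q \<mu>" and X0_law: "distr Q \<mu> X0 = \<mu>"
    and eps_density: "distributed Q lborel eps (\<lambda>y. ennreal (\<psi> y))"
    and eps_indep: "indep_rvs Q \<mu> X0 borel eps"
    and eps_mean: "integrable Q eps" "(\<integral>q. eps q \<partial>Q) = 0"
    and eps_var: "integrable Q (\<lambda>q. (eps q)\<^sup>2)" "(\<integral>q. (eps q)\<^sup>2 \<partial>Q) = \<sigma>\<^sup>2"
    and Y0: "\<And>q. q \<in> space Q \<Longrightarrow> Y0 q = K f (X0 q) + eps q"
    and P: "prob_space P"
    and sample_indep: "prob_space.indep_vars P (\<lambda>_. \<mu> \<Otimes>\<^sub>M borel) (\<lambda>i w. (X i w, Y i w)) UNIV"
    and sample_law: "\<And>i. distr P (\<mu> \<Otimes>\<^sub>M borel) (\<lambda>w. (X i w, Y i w)) =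
                          distr Q (\<mu> \<Otimes>\<^sub>M borel) (\<lambda>q. (X0 q, Y0 q))"
    and psi_pos: "\<And>y. 0 < \<psi> y"
    and psi_diff: "\<And>y. \<psi> differentiable at y" "\<And>y. deriv \<psi> differentiable at y"
    and score_diff: "\<And>y. score \<psi> differentiable at y" "\<And>y. deriv (score \<psi>) differentiable at y"
    and score_deriv_bdd: "bounded (range (deriv (score \<psi>)))"
                         "bounded (range (deriv (deriv (score \<psi>))))"
    and fisher_finite: "integrable lborel (\<lambda>y. (deriv \<psi> y / \<psi> y)\<^sup>2 * \<psi> y)"
    and score_sq: "integrable Q (\<lambda>q. (score \<psi> (eps q))\<^sup>2)"
                  "(\<integral>q. (score \<psi> (eps q))\<^sup>2 \<partial>Q) = fisher_information \<psi>"
    and score_deriv: "integrable Q (\<lambda>q. deriv (score \<psi>) (eps q))"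
                     "(\<integral>q. deriv (score \<psi>) (eps q) \<partial>Q) = fisher_information \<psi>"
    and m_top: "filterlim m at_top sequentially"
    and m_rate: "(\<lambda>n. real (m n) / sqrt (real n)) \<longlonglongrightarrow> 0"
    and fc_summable: "summable (\<lambda>k. (fc k)\<^sup>2)" "summable (\<lambda>k. \<bar>fc k\<bar>)"
    and fc_sq_tail: "(\<lambda>n. sqrt (real n) * (\<Sum>k. (fc (m n + 1 + k))\<^sup>2)) \<longlonglongrightarrow> 0"
    and fc_abs_tail: "(\<lambda>n. \<Sum>k. \<bar>fc (m n + 1 + k)\<bar>) \<longlonglongrightarrow> 0"
  shows "asymptotically_efficient P (one_step_estimator \<nu> K \<phi> \<rho> \<phi>V \<psi> m X Y) (fc 0)
           (optimal_variance \<nu> \<mu> K \<psi> (\<rho> 0) (\<phi>V 0) f)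
       \<and> converges_in_distribution P
           (\<lambda>n w. sqrt (real n) * (one_step_estimator \<nu> K \<phi> \<rho> \<phi>V \<psi> m X Y n w - fc 0))
           (Normal 0 (1 / ((\<rho> 0)\<^sup>2 * fisher_information \<psi>)))
       \<and> 1 / ((\<rho> 0)\<^sup>2 * fisher_information \<psi>)
           = optimal_variance \<nu> \<mu> K \<psi> (\<rho> 0) (\<phi>V 0) f"
proof -
  interpret Q: prob_space Q by (rule Q)
  interpret P: prob_space P by (rule P)
  interpret mu: prob_space \<mu> using mu by (rule prob_spaceI)
  interpret polar_eigenbasis \<mu> \<nu> K V Kstar Vstar R \<phi> \<rho>
    using K polar basis eigen rho_pos by unfold_locales

  have psi_nonneg: "0 \<le> \<psi> y" for y using psi_pos[of y] by simp
  have psi_meas [measurable]: "\<psi> \<in> borel_measurable borel" "score \<psi> \<in> borel_measurable borel"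
    "deriv (score \<psi>) \<in> borel_measurable borel"
    using psi_diff score_diff by (auto intro!: borel_measurable_continuous_onI
        simp: continuous_on_eq_continuous_at differentiable_imp_continuous_within)
  note density = distributed_integral[OF eps_density _ psi_nonneg] distributed_integrable[OF eps_density _ psi_nonneg]
  have psi_int: "integrable lborel \<psi>" "(\<integral>y. \<psi> y \<partial>lborel) = 1"
    using density(1)[of "\<lambda>_. 1"] density(2)[of "\<lambda>_. 1"] by (simp_all add: Q.prob_space)
  have psi_sq: "integrable lborel (\<lambda>y. y\<^sup>2 * \<psi> y)"
    using density(2)[of "\<lambda>y. y\<^sup>2"] eps_var(1) by (simp add: mult.commute)
  interpret smooth_density \<psi>
    using psi_pos psi_diff psi_int psi_sq fisher_finite by unfold_locales
  let ?I = "fisher_information \<psi>"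

  have v0: "\<phi>V 0 \<in> L2 \<mu>" "L2_inner \<mu> (\<phi>V 0) (\<phi>V 0) = 1"
    by (simp_all add: phiV V_phi_L2 V_phi_orthonormal)
  have opt: "optimal_variance \<nu> \<mu> K \<psi> (\<rho> 0) (\<phi>V 0) f = 1 / ((\<rho> 0)\<^sup>2 * ?I)"
    using V_phi_range_closure[of _ 0] L2_operatorD(1)[OF K f]
    by (intro optimal_variance_eq mu.prob_space_axioms rho_pos v0) (auto simp: phiV)

  define N where "N = distr Q borel eps"
  have eps_meas [measurable]: "eps \<in> borel_measurable Q"
    using eps_density by (simp add: distributed_def)
  have N_prob: "prob_space N" unfolding N_def by (rule Q.prob_space_distr) simp
  have N_integral: "(\<integral>e. h e \<partial>N) = (\<integral>q. h (eps q) \<partial>Q)" "integrable N h \<longleftrightarrow> integrable Q (\<lambda>q. h (eps q))"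
    if [measurable]: "h \<in> borel_measurable borel" for h :: "real \<Rightarrow> real"
    unfolding N_def by (simp_all add: integral_distr integrable_distr_eq)
  \<comment> \<open>The density cancels the denominator of the score, and what remains is minus the
    integral of the derivative of the density.\<close>
  have score_mean: "(\<integral>e. score \<psi> e \<partial>N) = 0"
  proof -
    have "\<psi> y * score \<psi> y = - deriv \<psi> y" for y
      using psi_pos[of y] by (simp add: score_def)
    then show ?thesis
      using density(1)[of "score \<psi>"] by (simp add: N_integral integral_deriv_psi)
  qed

  define g where "g = K f"
  have g_L2: "g \<in> L2 \<mu>" unfolding g_def by (rule L2_operatorD(1)[OF K f])
  then have [measurable]: "g \<in> borel_measurable \<mu>" by (simp add: L2_def)
  have w_meas [measurable]: "\<phi>V k \<in> borel_measurable \<mu>" for k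
    using V_phi_L2[of k] by (simp add: phiV L2_def)
  have K_phi_meas [measurable]: "K (\<phi> k) \<in> borel_measurable \<mu>" for k
    using L2_operatorD(1)[OF K phi_L2[of k]] by (simp add: L2_def)

  let ?XY = "\<lambda>i \<omega>. (X i \<omega>, Y i \<omega>)"
  have XY [measurable]: "?XY i \<in> measurable P (\<mu> \<Otimes>\<^sub>M borel)" for i
    using sample_indep by (simp add: P.indep_vars_def2)
  have X_meas [measurable]: "X i \<in> measurable P \<mu>" and Y_meas [measurable]: "Y i \<in> borel_measurable P" for i
    using measurable_compose[OF XY[of i] measurable_fst] measurable_compose[OF XY[of i] measurable_snd]
    by simp_all
  \<comment> \<open>The sample consists of pairs (X, Y) only; this map recovers the unobserved
    errors as a measurable function of each pair, so independence carries over to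
    \<open>Z\<close>.\<close>
  define \<Phi> where "\<Phi> = (\<lambda>(x, y). (x, y - g x))"
  have sets_N: "sets N = sets borel" by (simp add: N_def)
  have \<Phi> [measurable]: "\<Phi> \<in> measurable (\<mu> \<Otimes>\<^sub>M borel) (\<mu> \<Otimes>\<^sub>M N)"
  proof -
    have "\<Phi> \<in> measurable (\<mu> \<Otimes>\<^sub>M borel) (\<mu> \<Otimes>\<^sub>M borel)" unfolding \<Phi>_def by measurable
    then show ?thesis
      by (simp add: measurable_cong_sets[OF refl sets_pair_measure_cong[OF refl sets_N]])
  qed
  define Z where "Z = (\<lambda>i \<omega>. \<Phi> (?XY i \<omega>))"
  have Z: "fst (Z i \<omega>) = X i \<omega>" "g (X i \<omega>) + snd (Z i \<omega>) = Y i \<omega>" for i \<omega>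
    by (simp_all add: Z_def \<Phi>_def)
  have Z_indep: "P.indep_vars (\<lambda>_. \<mu> \<Otimes>\<^sub>M N) Z UNIV"
    unfolding Z_def by (rule P.indep_vars_compose2[OF sample_indep]) simp
  \<comment> \<open>The errors live on \<open>Q\<close>, the sample on \<open>P\<close>. Only the
    laws of the pairs agree, so the law is transported to \<open>Q\<close>, where the map returns
    (X0, eps), whose components are independent.\<close>
  have Z_law: "distr P (\<mu> \<Otimes>\<^sub>M N) (Z i) = \<mu> \<Otimes>\<^sub>M N" for i
  proof -
    have XY0: "(\<lambda>q. (X0 q, Y0 q)) \<in> measurable Q (\<mu> \<Otimes>\<^sub>M borel)"
    proof -
      have "(\<lambda>q. (X0 q, g (X0 q) + eps q)) \<in> measurable Q (\<mu> \<Otimes>\<^sub>M borel)"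
        using X0 by measurable
      then show ?thesis by (rule measurable_cong[THEN iffD1, rotated]) (simp add: Y0 g_def)
    qed
    have "distr P (\<mu> \<Otimes>\<^sub>M N) (Z i) = distr (distr P (\<mu> \<Otimes>\<^sub>M borel) (?XY i)) (\<mu> \<Otimes>\<^sub>M N) \<Phi>"
      unfolding Z_def by (simp add: distr_distr comp_def)
    also have "\<dots> = distr Q (\<mu> \<Otimes>\<^sub>M N) (\<lambda>q. \<Phi> (X0 q, Y0 q))"
      unfolding sample_law using XY0 by (simp add: distr_distr comp_def)
    also have "\<dots> = distr Q (\<mu> \<Otimes>\<^sub>M borel) (\<lambda>q. (X0 q, eps q))"
      by (rule distr_cong) (simp_all add: Y0 \<Phi>_def g_def sets_N cong: sets_pair_measure_cong)
    also have "\<dots> = \<mu> \<Otimes>\<^sub>M N"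
      using Q.indep_rvs_pair_distr[OF eps_indep] by (simp add: X0_law N_def)
    finally show ?thesis .
  qed

  obtain B where B: "\<And>k x. x \<in> space \<mu> \<Longrightarrow> \<bar>\<phi>V k x\<bar> \<le> B"
    using phiV_bdd unfolding bdd_above_def by blast
  obtain C1 where C1: "\<And>y. \<bar>deriv (score \<psi>) y\<bar> \<le> C1"
    using score_deriv_bdd(1) unfolding bounded_iff by auto
  obtain C2 where C2: "\<And>y. \<bar>deriv (deriv (score \<psi>)) y\<bar> \<le> C2"
    using score_deriv_bdd(2) unfolding bounded_iff by auto

  interpret S: regression_sample P Z \<mu> N g \<phi>V "\<lambda>k. \<rho> k * fc k" "score \<psi>" ?I B C1 C2
  proof (intro regression_sample.intro iid_sample.intro iid_sample_axioms.intro
      regression_sample_axioms.intro P.prob_space_axioms mu.prob_space_axioms N_prob sets_N)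
    show "\<rho> k * fc k = (\<integral>x. g x * \<phi>V k x \<partial>\<mu>)" for k
      using inner_K_V_phi[OF f, of k] by (simp add: fc g_def phiV L2_inner_def)
    show "(\<integral>x. \<phi>V k x * \<phi>V l x \<partial>\<mu>) = (if k = l then 1 else 0)" for k l
      using V_phi_orthonormal[of k l] by (simp add: phiV L2_inner_def)
    show "integrable \<mu> (\<lambda>x. (g x)\<^sup>2)" using g_L2 by (simp add: L2_def)
  qed (use Z_indep Z_law eps_mean eps_var score_sq score_deriv score_mean score_diff B C1 C2
      fisher_information_pos in \<open>simp_all add: N_integral\<close>)

  let ?\<theta> = "one_step_estimator \<nu> K \<phi> \<rho> \<phi>V \<psi> m X Y"
  have coeff_meas [measurable]: "coeff_estimator \<rho> \<phi>V X Y n k \<in> borel_measurable P" for n k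
    unfolding coeff_estimator_def[abs_def] by measurable
  have \<theta>_meas: "?\<theta> n \<in> borel_measurable P" for n
    unfolding one_step_estimator_def[abs_def] span_version_series_estimator by measurable

  have coeff: "coeff_estimator \<rho> \<phi>V X Y n k \<omega> = S.ahat n k \<omega> / \<rho> k" for n k \<omega>
    by (simp add: coeff_estimator_def S.ahat_def avg_def Z sum_divide_distrib mult_ac)
  \<comment> \<open>Countably many exceptional null sets are removed at once. Off them, the factor
    \<open>\<rho> k\<close> cancels the \<open>1 / \<rho> k\<close> of the coefficient estimator,
    leaving the fitted regression function of the model.\<close>
  have "AE \<omega> in P. \<forall>k i. K (\<phi> k) (X i \<omega>) = \<rho> k * \<phi>V k (X i \<omega>)"
    unfolding AE_all_countable using S.AE_sample_fst[OF K_phi] by (simp add: Z phiV)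
  then have \<theta>_eq: "AE \<omega> in P. ?\<theta> n \<omega> = S.one_step n (m n) \<omega> / \<rho> 0" for n
  proof eventually_elim
    case (elim \<omega>)
    have "span_version \<nu> \<phi> (m n) K (series_estimator \<phi> \<rho> \<phi>V X Y n (m n) \<omega>) (X i \<omega>)
        = (\<Sum>k\<le>m n. S.ahat n k \<omega> * \<phi>V k (X i \<omega>))" for i
      unfolding span_version_series_estimator coeff
      using elim rho_pos by (intro sum.cong refl) (simp add: less_imp_neq[OF rho_pos, symmetric])
    then show ?case
      by (simp add: one_step_estimator_def S.one_step_def coeff Z avg_def add_divide_distrib
          sum_divide_distrib mult_ac)
  qed

  \<comment> \<open>Since the model coefficients are \<open>\<rho> k * fc k\<close>, the remainder
    in the model is the truncation remainder of \<open>K f\<close>, controlled by the squared tail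
    of the coefficients of \<open>f\<close>.\<close>
  have tail: "(\<lambda>n. sqrt (real n) * S.delta (m n)) \<longlonglongrightarrow> 0"
  proof -
    obtain C where "\<forall>j. (\<integral>x. (K f x - (\<Sum>k\<le>j. \<rho> k * L2_inner \<nu> f (\<phi> k) * V (\<phi> k) x))\<^sup>2 \<partial>\<mu>)
        \<le> C * (\<Sum>k. (L2_inner \<nu> f (\<phi> (j + 1 + k)))\<^sup>2)"
      using K_remainder_bound[OF f] by blast
    then have C: "S.delta j \<le> C * (\<Sum>k. (fc (j + 1 + k))\<^sup>2)" for j
      unfolding S.delta_def S.resid_def unfolding g_def fc phiV by blast
    have lim: "(\<lambda>n. C * (sqrt (real n) * (\<Sum>k. (fc (m n + 1 + k))\<^sup>2))) \<longlonglongrightarrow> 0"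
      using tendsto_mult_left[OF fc_sq_tail, of C] by simp
    show ?thesis
    proof (rule real_tendsto_sandwich[OF _ _ tendsto_const lim])
      show "\<forall>\<^sub>F n in sequentially. sqrt (real n) * S.delta (m n)
          \<le> C * (sqrt (real n) * (\<Sum>k. (fc (m n + 1 + k))\<^sup>2))"
      proof (rule always_eventually, rule allI)
        fix n
        have "sqrt (real n) * S.delta (m n) \<le> sqrt (real n) * (C * (\<Sum>k. (fc (m n + 1 + k))\<^sup>2))"
          by (rule mult_left_mono[OF C]) simp
        then show "sqrt (real n) * S.delta (m n) \<le> C * (sqrt (real n) * (\<Sum>k. (fc (m n + 1 + k))\<^sup>2))"
          by (simp add: mult_ac)
      qed
    qed (simp add: S.delta_def)
  qed

  have "weak_conv_m (\<lambda>n. distr P borel (\<lambda>\<omega>. sqrt (real n) * (?\<theta> n \<omega> - fc 0))) (Normal 0 (1 / ((\<rho> 0)\<^sup>2 * ?I)))"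
    using S.one_step_weak_conv[OF m_rate tail rho_pos \<theta>_meas \<theta>_eq] rho_pos[of 0] by simp
  then have "converges_in_distribution P (\<lambda>n \<omega>. sqrt (real n) * (?\<theta> n \<omega> - fc 0)) (Normal 0 (1 / ((\<rho> 0)\<^sup>2 * ?I)))"
    using \<theta>_meas by (simp add: converges_in_distribution_def)
  then show ?thesis by (simp add: asymptotically_efficient_def opt)
qed

end
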